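(* Let $0<\tau<1$ be a constant, and let $0<\varepsilon,\delta<1/2$ with $\varepsilon<\min(\tau,1-\tau)/2$. There is an algorithm (called BayesianScreeningSearch) which, on any $\textsc{MonotonicNBS}(\tau,\varepsilon)$ instance with $n$ coins, uses at most \[ \frac{1}{C_{\tau,\varepsilon}}\left(\lg n + O\!\left(\log^{2/3} n\,\log^{1/3}\tfrac{1}{\delta} + \log\tfrac{1}{\delta}\right)\right) \] coin flips (queries) and succeeds with probability at least $1-\delta$.
   Context: A $\textsc{MonotonicNBS}(\tau,\varepsilon)$ instance consists of $n$ coins with unknown biases $p_1\le p_2\le\dots\le p_n$ in $[0,1]$; a query flips a chosen coin $i$, returning $1$ with probability $p_i$ and $0$ otherwise, independently of all other flips. An index $i\in\{1,\dots,n-1\}$ (interval $[i,i+1]$) is $(\tau,\varepsilon)$-good if $[p_i,p_{i+1}]\cap(\tau-\varepsilon,\tau+\varepsilon)\neq\emptyset$. An algorithm succeeds if it outputs a $(\tau,\varepsilon)$-good index. $H(p)=-p\lg p-(1-p)\lg(1-p)$ is the binary entropy ($\lg=\log_2$), and $C_{\tau,\varepsilon}=\max_{q} \big[H((1-q)(\tau-\varepsilon)+q(\tau+\varepsilon))-(1-q)H(\tau-\varepsilon)-qH(\tau+\varepsilon)\big]$ is the capacity of the binary asymmetric channel. Asymptotics are as $n\to\infty$, with $\varepsilon,\delta$ possibly depending on $n$.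
   Formalization: The success guarantee is stated for n ≥ 2 and for instances in which at least one (τ,ε)-good index exists; without this (e.g. all biases 0) no algorithm can succeed, so the claim read literally fails there. *)

theory Defs
  imports "HOL-Probability.Probability"
begin

definition binary_entropy :: "real \<Rightarrow> real" where
  "binary_entropy p = - p * log 2 p - (1 - p) * log 2 (1 - p)"

definition bac_information :: "real \<Rightarrow> real \<Rightarrow> real \<Rightarrow> real" where
  "bac_information \<tau> \<epsilon> q =
     binary_entropy ((1 - q) * (\<tau> - \<epsilon>) + q * (\<tau> + \<epsilon>))
       - (1 - q) * binary_entropy (\<tau> - \<epsilon>) - q * binary_entropy (\<tau> + \<epsilon>)"

text \<open>The maximum over input distributions \<open>q\<close>, written as a supremum; it is attained, see
  \<open>bac_capacity_attained\<close> below.\<close>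

definition bac_capacity :: "real \<Rightarrow> real \<Rightarrow> real" where
  "bac_capacity \<tau> \<epsilon> = (SUP q\<in>{0..1}. bac_information \<tau> \<epsilon> q)"

lemma bac_capacity_attained:
  assumes "0 < \<epsilon>" "0 < \<tau> - \<epsilon>" "\<tau> + \<epsilon> < 1"
  shows "\<exists>q\<in>{0..1}. bac_capacity \<tau> \<epsilon> = bac_information \<tau> \<epsilon> q \<and>
           (\<forall>r\<in>{0..1}. bac_information \<tau> \<epsilon> r \<le> bac_information \<tau> \<epsilon> q)"
proof -
  have pos: "0 < (1 - q) * (\<tau> - \<epsilon>) + q * (\<tau> + \<epsilon>)"
    and lt1: "(1 - q) * (\<tau> - \<epsilon>) + q * (\<tau> + \<epsilon>) < 1" if "q \<in> {0..1}" for q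
  proof -
    have eq: "(1 - q) * (\<tau> - \<epsilon>) + q * (\<tau> + \<epsilon>) = \<tau> - \<epsilon> + 2 * (q * \<epsilon>)"
      by (simp add: algebra_simps)
    have "0 \<le> q * \<epsilon>" "q * \<epsilon> \<le> 1 * \<epsilon>"
      using that assms by (auto intro!: mult_right_mono)
    then show "0 < (1 - q) * (\<tau> - \<epsilon>) + q * (\<tau> + \<epsilon>)"
      and "(1 - q) * (\<tau> - \<epsilon>) + q * (\<tau> + \<epsilon>) < 1"
      using assms unfolding eq by linarith+
  qed
  have "continuous_on {0..1} (bac_information \<tau> \<epsilon>)"
    unfolding bac_information_def binary_entropy_def log_def
    by (intro continuous_intros ballI) (use pos lt1 in \<open>fastforce\<close>)+
  then obtain q where q: "q \<in> {0..1}"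
      "\<forall>r\<in>{0..1}. bac_information \<tau> \<epsilon> r \<le> bac_information \<tau> \<epsilon> q"
    using continuous_attains_sup[of "{0..1::real}" "bac_information \<tau> \<epsilon>"] by auto
  then have "bac_capacity \<tau> \<epsilon> = bac_information \<tau> \<epsilon> q"
    unfolding bac_capacity_def by (intro cSup_eq_maximum) auto
  with q show ?thesis by blast
qed

definition nbs_instance :: "nat \<Rightarrow> (nat \<Rightarrow> real) \<Rightarrow> bool" where
  "nbs_instance n p \<longleftrightarrow> p ` {1..n} \<subseteq> {0..1} \<and> mono_on {1..n} p"

definition good_index :: "real \<Rightarrow> real \<Rightarrow> nat \<Rightarrow> (nat \<Rightarrow> real) \<Rightarrow> nat \<Rightarrow> bool" where
  "good_index \<tau> \<epsilon> n p i \<longleftrightarrow>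
     i \<in> {1..n - 1} \<and> {p i..p (i + 1)} \<inter> {\<tau> - \<epsilon><..<\<tau> + \<epsilon>} \<noteq> {}"

text \<open>A deterministic adaptive strategy is a decision tree: \<open>Flip i t\<^sub>0 t\<^sub>1\<close> flips coin \<open>i\<close> and
  continues with \<open>t\<^sub>1\<close> if the result is 1 and with \<open>t\<^sub>0\<close> otherwise. Randomized algorithms are
  distributions over such trees; this loses no generality, since up to the (irrelevant) invalid
  outputs there are only finitely many trees of bounded depth on \<open>n\<close> coins.\<close>

datatype search_tree = Output nat | Flip nat search_tree search_tree

primrec coins_queried :: "search_tree \<Rightarrow> nat set" where
  "coins_queried (Output j) = {}"
| "coins_queried (Flip i t0 t1) = {i} \<union> coins_queried t0 \<union> coins_queried t1"

primrec max_queries :: "search_tree \<Rightarrow> nat" where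
  "max_queries (Output j) = 0"
| "max_queries (Flip i t0 t1) = Suc (max (max_queries t0) (max_queries t1))"

primrec run_tree :: "(nat \<Rightarrow> real) \<Rightarrow> search_tree \<Rightarrow> nat pmf" where
  "run_tree p (Output j) = return_pmf j"
| "run_tree p (Flip i t0 t1) =
     bind_pmf (bernoulli_pmf (p i)) (\<lambda>b. if b then run_tree p t1 else run_tree p t0)"

definition run_alg :: "(nat \<Rightarrow> real) \<Rightarrow> search_tree pmf \<Rightarrow> nat pmf" where
  "run_alg p A = bind_pmf A (run_tree p)"

lemma good_index_exists_if_crossing:
  assumes "nbs_instance n p" "2 \<le> n" "0 < \<epsilon>" "p 1 \<le> \<tau>" "\<tau> \<le> p n"
  shows "\<exists>i. good_index \<tau> \<epsilon> n p i"
proof -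
  define S where "S = {i \<in> {1..n - 1}. p i \<le> \<tau>}"
  have S: "finite S" "1 \<in> S" using assms by (auto simp: S_def)
  define m where "m = Max S"
  have m: "m \<in> S" unfolding m_def using S by (intro Max_in) auto
  have "\<tau> \<le> p (m + 1)"
  proof (cases "m = n - 1")
    case True
    then show ?thesis using assms by simp
  next
    case False
    have "m + 1 \<notin> S" using Max_ge[OF S(1), of "m + 1"] unfolding m_def[symmetric] by auto
    then show ?thesis using False m by (auto simp: S_def)
  qed
  then have "\<tau> \<in> {p m..p (m + 1)} \<inter> {\<tau> - \<epsilon><..<\<tau> + \<epsilon>}"
    using m assms by (auto simp: S_def)
  then show ?thesis using m unfolding good_index_def S_def by blast
qed

end

theory Submission imports Defs begin

text \<open>
  Let \<open>m\<close> be the bias with equal relative entropies \<open>c\<close> from \<open>\<tau> - \<epsilon>\<close> and \<open>\<tau> + \<epsilon>\<close>; then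
  \<open>c = C ln 2\<close> for the capacity \<open>C\<close>. Keep a Bayesian posterior on the intervals, as if every coin left
  of the sought interval had bias \<open>\<tau> - \<epsilon>\<close> and every coin to its right \<open>\<tau> + \<epsilon>\<close>, and always flip an
  end of the interval \<open>x\<close> at which the predicted bias is \<open>m\<close>. If \<open>x\<close> is not good with margin
  \<open>\<eta> \<epsilon>\<close>, the log-weight of the interval crossing \<open>\<tau>\<close> grows by \<open>c (1 - O(\<eta>))\<close> in expectation, and
  otherwise it drops by at most \<open>O(c)\<close>. As weights are at most 1, an exponential supermartingale with
  exponent \<open>\<eta>\<close> shows that among \<open>M = (1 + O(\<eta>)) (ln n + O(log (1/\<delta>)) / \<eta>) / c\<close> visited intervals at
  least \<open>\<eta> M\<close> are good with margin, except with probability \<open>\<delta>/3\<close>. Good intervals are consecutive, so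
  one of them is among the \<open>1/\<eta>\<close> order statistics of rank a multiple of \<open>\<eta> M\<close>. Crude tests against
  \<open>\<tau>\<close> locate two neighbouring candidates one of which is good, and a single test of accuracy
  \<open>\<eta> \<epsilon>\<close>, costing \<open>O(log (1/\<delta>) / (\<eta> \<epsilon>)\<^sup>2)\<close>, decides between them. Balancing
  \<open>\<eta> log n\<close> against \<open>log (1/\<delta>) / \<eta>\<^sup>2\<close> gives \<open>\<eta> \<approx> (log (1/\<delta>) / log n)\<^sup>1\<^sup>/\<^sup>3\<close>.

  Virtual coins of bias 0 and 1 at the two ends guarantee that some interval crosses \<open>\<tau>\<close>.
\<close>

section \<open>Second-order bounds on exponentials\<close>

lemma exp_le_quadratic:
  fixes x :: real
  assumes "\<bar>x\<bar> \<le> 1"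
  shows "exp x \<le> 1 + x + x\<^sup>2"
proof (cases "0 \<le> x")
  case True
  then show ?thesis using exp_bound[of x] assms by auto
next
  case False
  define y where "y = - x"
  have y: "0 < y" "y \<le> 1" using False assms by (auto simp: y_def)
  have "1 + y + y\<^sup>2/2 \<le> exp y" using exp_lower_Taylor_quadratic[of y] y by simp
  \<comment> \<open>This makes \<open>1 - y + y\<^sup>2\<close> an upper bound for the reciprocal of
    the Taylor lower bound of \<open>exp y\<close>.\<close>
  moreover have "1 \<le> (1 - y + y\<^sup>2) * (1 + y + y\<^sup>2/2)"
  proof -
    have "(1 - y + y\<^sup>2) * (1 + y + y\<^sup>2/2) = 1 + y\<^sup>2 * (1/2 + y / 2 + y\<^sup>2/2)"
      by (simp add: power2_eq_square field_simps)
    then show ?thesis using y by simp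
  qed
  moreover have "0 \<le> 1 - y + y\<^sup>2" using y by simp
  ultimately have "1 \<le> (1 - y + y\<^sup>2) * exp y"
    by (meson mult_left_mono order_trans)
  then have "exp (- y) \<le> 1 - y + y\<^sup>2"
    by (simp add: exp_minus field_simps)
  then show ?thesis by (simp add: y_def)
qed

text \<open>The mean stays exact in the exponent and the spread enters only through
  \<open>v\<close>. Both the Chernoff bounds for the tests and the supermartingale of the learning
  phase rest on this.\<close>

lemma two_point_mgf_le:
  fixes p x y v :: real
  assumes "0 \<le> p" "p \<le> 1" "\<bar>x\<bar> \<le> 1" "\<bar>y\<bar> \<le> 1" "x\<^sup>2 \<le> v" "y\<^sup>2 \<le> v"
  shows "p * exp x + (1 - p) * exp y \<le> exp (p * x + (1 - p) * y + v)"
proof -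
  have "p * exp x + (1 - p) * exp y \<le> p * (1 + x + v) + (1 - p) * (1 + y + v)"
    using exp_le_quadratic[of x] exp_le_quadratic[of y] assms
    by (intro add_mono mult_left_mono) auto
  also have "\<dots> = 1 + (p * x + (1 - p) * y + v)" by (simp add: algebra_simps)
  also have "\<dots> \<le> exp (p * x + (1 - p) * y + v)" by (rule exp_ge_add_one_self)
  finally show ?thesis .
qed

section \<open>Failure probability of a decision tree\<close>

text \<open>A real-valued recursion for the failure probability, so that error bounds follow by
  plain induction on the construction of a tree.\<close>

primrec miss_prob :: "(nat \<Rightarrow> real) \<Rightarrow> nat set \<Rightarrow> search_tree \<Rightarrow> real" where
  "miss_prob p S (Output j) = (if j \<in> S then 0 else 1)"
| "miss_prob p S (Flip i t0 t1) = p i * miss_prob p S t1 + (1 - p i) * miss_prob p S t0"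

text \<open>The assumption concerns queried coins only, because an instance says nothing about
  \<open>p\<close> outside \<open>{1..n}\<close>.\<close>

lemma prob_run_tree:
  assumes "\<forall>i\<in>coins_queried t. 0 \<le> p i \<and> p i \<le> 1"
  shows "measure_pmf.prob (run_tree p t) S = 1 - miss_prob p S t"
  using assms
proof (induction t)
  case (Output j)
  then show ?case by (simp add: measure_return_pmf indicator_def)
next
  case (Flip i t0 t1)
  have "measure_pmf.prob (run_tree p (Flip i t0 t1)) S =
      measure_pmf.expectation (bernoulli_pmf (p i))
        (\<lambda>b. measure_pmf.prob (if b then run_tree p t1 else run_tree p t0) S)"
    unfolding run_tree.simps measure_pmf_bind
    by (subst measure_pmf.measure_bind[where N = "count_space UNIV"])
       (auto simp: space_subprob_algebra intro: prob_space_imp_subprob_space measure_pmf.prob_space_axioms)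
  also have "\<dots> = p i * (1 - miss_prob p S t1) + (1 - p i) * (1 - miss_prob p S t0)"
    using Flip by (subst integral_bernoulli_pmf) auto
  finally show ?case by (simp add: algebra_simps)
qed

lemma miss_prob_bounds:
  assumes "\<And>i. 0 \<le> p i" "\<And>i. p i \<le> 1"
  shows "0 \<le> miss_prob p S t" "miss_prob p S t \<le> 1"
proof -
  have "measure_pmf.prob (run_tree p t) S = 1 - miss_prob p S t"
    using assms by (intro prob_run_tree) auto
  then show "0 \<le> miss_prob p S t" "miss_prob p S t \<le> 1"
    using measure_pmf.prob_le_1[of "run_tree p t" S] measure_nonneg[of "run_tree p t" S] by linarith+
qed

section \<open>Virtual end coins\<close>

definition pad :: "nat \<Rightarrow> (nat \<Rightarrow> real) \<Rightarrow> nat \<Rightarrow> real" where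
  "pad n p i = (if i = 0 then 0 else if i > n then 1 else p i)"

text \<open>For monotone \<open>p\<close> this is goodness without the range condition on the index.
  Goodness with margin \<open>\<gamma>\<close> is obtained by putting
  \<open>\<epsilon> - \<gamma>\<close> for \<open>\<epsilon>\<close>.\<close>

definition straddles :: "real \<Rightarrow> real \<Rightarrow> (nat \<Rightarrow> real) \<Rightarrow> nat \<Rightarrow> bool" where
  "straddles \<tau> \<epsilon> p j \<longleftrightarrow> p j < \<tau> + \<epsilon> \<and> \<tau> - \<epsilon> < p (Suc j)"

text \<open>The result of flipping a virtual coin is certain, so its branch can be followed without
  a query; answers naming a virtual interval move to the nearest real one.\<close>

primrec prune :: "nat \<Rightarrow> search_tree \<Rightarrow> search_tree" where
  "prune n (Output j) = Output (max 1 (min (n - 1) j))"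
| "prune n (Flip i t0 t1) =
     (if i = 0 then prune n t0 else if i > n then prune n t1 else Flip i (prune n t0) (prune n t1))"

lemma coins_queried_prune: "coins_queried (prune n t) \<subseteq> {1..n}"
  by (induction t) auto

lemma max_queries_prune: "max_queries (prune n t) \<le> max_queries t"
  by (induction t) auto

lemma pad_bounds:
  assumes "nbs_instance n p"
  shows "0 \<le> pad n p i" "pad n p i \<le> 1"
  using assms unfolding nbs_instance_def pad_def by (auto simp: image_subset_iff)

lemma mono_pad:
  assumes "nbs_instance n p"
  shows "mono (pad n p)"
proof (rule monoI)
  fix i j :: nat assume "i \<le> j"
  show "pad n p i \<le> pad n p j"
  proof (cases "i = 0 \<or> j > n")
    case True
    then show ?thesis using pad_bounds[OF assms, of i] pad_bounds[OF assms, of j] \<open>i \<le> j\<close>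
      by (auto simp: pad_def)
  next
    case False
    then show ?thesis using assms \<open>i \<le> j\<close> unfolding nbs_instance_def pad_def
      by (auto simp: mono_on_def)
  qed
qed

lemma good_index_iff_straddles:
  assumes "nbs_instance n p" "0 < \<epsilon>" "i \<in> {1..n - 1}"
  shows "good_index \<tau> \<epsilon> n p i \<longleftrightarrow> straddles \<tau> \<epsilon> p i"
proof
  assume "good_index \<tau> \<epsilon> n p i"
  then show "straddles \<tau> \<epsilon> p i" unfolding good_index_def straddles_def by auto
next
  assume *: "straddles \<tau> \<epsilon> p i"
  have "i \<in> {1..n}" "Suc i \<in> {1..n}" using assms(3) by auto
  then have "p i \<le> p (Suc i)"
    using assms(1) monotone_onD[of "{1..n}" "(\<le>)" "(\<le>)" p i "Suc i"] by (simp add: nbs_instance_def)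
  \<comment> \<open>The witness is the projection of \<open>\<tau>\<close> onto the
    interval.\<close>
  then have "max (p i) (min (p (Suc i)) \<tau>) \<in> {p i..p (i + 1)} \<inter> {\<tau> - \<epsilon><..<\<tau> + \<epsilon>}"
    using * assms(2) unfolding straddles_def by (auto simp: max_def min_def)
  then show "good_index \<tau> \<epsilon> n p i" using assms(3) unfolding good_index_def by blast
qed

text \<open>If interval 0 straddles, then \<open>p 1\<close> exceeds
  \<open>\<tau> - \<epsilon>\<close>; it is also below \<open>\<tau> + \<epsilon>\<close>, being at
  most the left end of a good interval. Hence interval 1 is good, and the right end is symmetric.
  Beyond \<open>n\<close> both ends have bias 1, too large to straddle.\<close>

lemma straddles_pad_clamp:
  assumes inst: "nbs_instance n p" "2 \<le> n" "0 < \<epsilon>"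
    and \<tau>: "0 \<le> \<tau> - \<epsilon>" "\<tau> + \<epsilon> \<le> 1"
    and ex: "\<exists>i. good_index \<tau> \<epsilon> n p i"
    and j: "straddles \<tau> \<epsilon> (pad n p) j"
  shows "good_index \<tau> \<epsilon> n p (max 1 (min (n - 1) j))"
proof -
  obtain i where i: "good_index \<tau> \<epsilon> n p i" using ex by blast
  have i1: "i \<in> {1..n - 1}" using i by (simp add: good_index_def)
  have si: "straddles \<tau> \<epsilon> p i" using i i1 good_index_iff_straddles inst by blast
  have le: "p x \<le> p y" if "1 \<le> x" "x \<le> y" "y \<le> n" for x y
    using inst(1) that unfolding nbs_instance_def mono_on_def by auto
  consider "j = 0" | "j \<in> {1..n - 1}" | "j = n" | "j > n" by fastforce
  then have "straddles \<tau> \<epsilon> p (max 1 (min (n - 1) j))"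
  proof cases
    case 1
    have "\<tau> - \<epsilon> < p 1" using j 1 inst by (auto simp: straddles_def pad_def split: if_splits)
    moreover have "p 1 \<le> p 2" "p 1 \<le> p i" using le[of 1 2] le[of 1 i] i1 inst by auto
    ultimately show ?thesis using 1 si by (auto simp: straddles_def numeral_2_eq_2)
  next
    case 2
    then have "max 1 (min (n - 1) j) = j" "pad n p j = p j" "pad n p (Suc j) = p (Suc j)"
      by (auto simp: pad_def)
    then show ?thesis using j by (simp add: straddles_def)
  next
    case 3
    have "p n < \<tau> + \<epsilon>" using j 3 inst by (auto simp: straddles_def pad_def split: if_splits)
    moreover have "max 1 (min (n - 1) j) = n - 1" "Suc (n - 1) = n" using 3 inst by auto
    moreover have "p (n - 1) \<le> p n" "p (Suc i) \<le> p n"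
      using le[of "n - 1" n] le[of "Suc i" n] i1 inst by auto
    ultimately show ?thesis using si by (simp only: straddles_def) linarith
  next
    case 4
    then show ?thesis using j \<tau> by (auto simp: straddles_def pad_def)
  qed
  then show ?thesis using good_index_iff_straddles inst by auto
qed

lemma miss_prob_prune:
  assumes inst: "nbs_instance n p"
    and imp: "\<And>j. j \<in> S \<Longrightarrow> max 1 (min (n - 1) j) \<in> T"
  shows "miss_prob p T (prune n t) \<le> miss_prob (pad n p) S t"
proof (induction t)
  case (Output j)
  then show ?case using imp by auto
next
  case (Flip i t0 t1)
  consider "i = 0" | "i > n" | "i \<in> {1..n}" by fastforce
  then show ?case
  proof cases
    case 3
    then have "pad n p i = p i" by (simp add: pad_def)
    then show ?thesis using 3 Flip pad_bounds[OF inst, of i]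
      by (auto intro!: add_mono mult_left_mono)
  qed (use Flip in \<open>auto simp: pad_def\<close>)
qed

section \<open>Threshold tests\<close>

text \<open>\<open>k\<close> is the number of ones still required for the verdict "high"; as a real
  number it admits thresholds \<open>N * \<theta>\<close> without rounding.\<close>

primrec threshold_test :: "nat \<Rightarrow> nat \<Rightarrow> real \<Rightarrow> search_tree \<Rightarrow> search_tree \<Rightarrow> search_tree" where
  "threshold_test i 0 k tL tH = (if k \<le> 0 then tH else tL)"
| "threshold_test i (Suc N) k tL tH =
     Flip i (threshold_test i N k tL tH) (threshold_test i N (k - 1) tL tH)"

lemma max_queries_threshold_test:
  "max_queries (threshold_test i N k tL tH) \<le> N + max (max_queries tL) (max_queries tH)"
proof (induction N arbitrary: k)
  case (Suc N)
  show ?case using Suc[of k] Suc[of "k - 1"] by simp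
qed auto

lemma miss_prob_threshold_test_le:
  assumes "0 \<le> p i" "p i \<le> 1" "miss_prob p S tL \<le> e" "miss_prob p S tH \<le> e"
  shows "miss_prob p S (threshold_test i N k tL tH) \<le> e"
proof (induction N arbitrary: k)
  case (Suc N)
  then show ?case using convex_bound_le[of "miss_prob p S (threshold_test i N (k - 1) tL tH)" e
      "miss_prob p S (threshold_test i N k tL tH)" "p i" "1 - p i"] assms by simp
qed (use assms in auto)

text \<open>A Chernoff bound by induction on the flips, with free parameter \<open>l\<close>. The
  sign \<open>\<sigma>\<close> is 1 if "low" is the right verdict and -1 if "high" is, so one
  induction serves both. After the last flip the exponential is at least 1 whenever the verdict is
  wrong.\<close>

lemma miss_prob_threshold_test_exp:
  assumes p: "\<And>i. 0 \<le> p i" "\<And>i. p i \<le> 1"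
    and right: "(\<sigma> = 1 \<and> miss_prob p S tL \<le> e) \<or> (\<sigma> = -1 \<and> miss_prob p S tH \<le> e)"
    and "0 \<le> e"
    and l: "0 \<le> l" "l \<le> 1"
  shows "miss_prob p S (threshold_test i N k tL tH) \<le> e + exp (\<sigma> * l * (N * p i - k) + N * l\<^sup>2)"
proof (induction N arbitrary: k)
  case 0
  have b: "miss_prob p S tL \<le> 1" "miss_prob p S tH \<le> 1"
    using miss_prob_bounds[of p] p by auto
  show ?case
  proof (cases "k \<le> 0")
    case True
    show ?thesis
    proof (cases "\<sigma> = 1")
      case True
      then have "1 \<le> exp (\<sigma> * l * (0 - k))" using \<open>k \<le> 0\<close> l by (simp add: mult_nonneg_nonpos)
      then have "miss_prob p S tH \<le> e + exp (\<sigma> * l * (0 - k))" using b \<open>0 \<le> e\<close> by linarith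
      then show ?thesis using \<open>k \<le> 0\<close> by simp
    next
      case False
      then show ?thesis using \<open>k \<le> 0\<close> right
        by (simp add: add_increasing2)
    qed
  next
    case False
    show ?thesis
    proof (cases "\<sigma> = 1")
      case True
      then show ?thesis using False right by (simp add: add_increasing2)
    next
      case s: False
      then have "1 \<le> exp (\<sigma> * l * (0 - k))" using False l right by simp
      then have "miss_prob p S tL \<le> e + exp (\<sigma> * l * (0 - k))" using b \<open>0 \<le> e\<close> by linarith
      then show ?thesis using False by simp
    qed
  qed
next
  case (Suc N)
  define q where "q = p i"
  define E where "E = exp (\<sigma> * l * (N * q - k) + N * l\<^sup>2)"
  have q: "0 \<le> q" "q \<le> 1" using p by (auto simp: q_def)
  have \<sigma>: "\<sigma> = 1 \<or> \<sigma> = -1" using right by auto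
  have mgf: "q * exp (\<sigma> * l) + (1 - q) * exp 0 \<le> exp (q * (\<sigma> * l) + (1 - q) * 0 + l\<^sup>2)"
    using q l \<sigma> by (intro two_point_mgf_le) (auto simp: power2_eq_square)
  have "miss_prob p S (threshold_test i (Suc N) k tL tH)
      \<le> q * (e + E * exp (\<sigma> * l)) + (1 - q) * (e + E)"
  proof -
    have "E * exp (\<sigma> * l) = exp (\<sigma> * l * (N * p i - (k - 1)) + N * l\<^sup>2)"
      unfolding E_def mult_exp_exp q_def by (simp add: algebra_simps)
    then show ?thesis using Suc[of k] Suc[of "k - 1"] q unfolding E_def
      by (auto intro!: add_mono mult_left_mono simp: q_def[symmetric])
  qed
  also have "\<dots> = e + E * (q * exp (\<sigma> * l) + (1 - q) * exp 0)" by (simp add: algebra_simps)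
  also have "\<dots> \<le> e + E * exp (q * (\<sigma> * l) + (1 - q) * 0 + l\<^sup>2)"
    using mgf by (intro add_mono mult_left_mono) (auto simp: E_def)
  also have "\<dots> = e + exp (\<sigma> * l * (Suc N * q - k) + Suc N * l\<^sup>2)"
    unfolding E_def mult_exp_exp by (simp add: algebra_simps)
  finally show ?case unfolding q_def .
qed

lemma miss_prob_threshold_test_low:
  assumes p: "\<And>i. 0 \<le> p i" "\<And>i. p i \<le> 1"
    and "miss_prob p S tL \<le> e" "0 \<le> e" "0 \<le> h" "h \<le> 1" "p i \<le> \<theta> - h"
  shows "miss_prob p S (threshold_test i N (N * \<theta>) tL tH) \<le> e + exp (- (N * h\<^sup>2 / 4))"
proof -
  \<comment> \<open>The choice \<open>l = h/2\<close> minimises the exponent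
    \<open>- l * N * h + N * l\<^sup>2\<close>.\<close>
  have "miss_prob p S (threshold_test i N (N * \<theta>) tL tH)
      \<le> e + exp (1 * (h/2) * (N * p i - N * \<theta>) + N * (h/2)\<^sup>2)"
    using assms by (intro miss_prob_threshold_test_exp) auto
  moreover have "(h/2) * (N * (p i - \<theta>)) \<le> (h/2) * (N * (- h))"
    using assms by (intro mult_left_mono) auto
  then have "1 * (h/2) * (N * p i - N * \<theta>) + N * (h/2)\<^sup>2 \<le> - (N * h\<^sup>2 / 4)"
    by (simp add: power2_eq_square field_simps)
  ultimately show ?thesis by (smt (verit) exp_le_cancel_iff)
qed

lemma miss_prob_threshold_test_high:
  assumes p: "\<And>i. 0 \<le> p i" "\<And>i. p i \<le> 1"
    and "miss_prob p S tH \<le> e" "0 \<le> e" "0 \<le> h" "h \<le> 1" "\<theta> + h \<le> p i"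
  shows "miss_prob p S (threshold_test i N (N * \<theta>) tL tH) \<le> e + exp (- (N * h\<^sup>2 / 4))"
proof -
  have "miss_prob p S (threshold_test i N (N * \<theta>) tL tH)
      \<le> e + exp (- 1 * (h/2) * (N * p i - N * \<theta>) + N * (h/2)\<^sup>2)"
    using assms by (intro miss_prob_threshold_test_exp) auto
  moreover have "(h/2) * (N * h) \<le> (h/2) * (N * (p i - \<theta>))"
    using assms by (intro mult_left_mono) auto
  then have "- 1 * (h/2) * (N * p i - N * \<theta>) + N * (h/2)\<^sup>2 \<le> - (N * h\<^sup>2 / 4)"
    by (simp add: power2_eq_square field_simps)
  ultimately show ?thesis by (smt (verit) exp_le_cancel_iff)
qed

section \<open>Relative entropy and the capacity\<close>

text \<open>The expected logarithmic growth of a weight that is multiplied by \<open>s / m\<close> when a coin of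
  bias \<open>p\<close> shows 1 and by \<open>(1 - s) / (1 - m)\<close> otherwise.\<close>

definition log_gain :: "real \<Rightarrow> real \<Rightarrow> real \<Rightarrow> real" where
  "log_gain s m p = p * ln (s / m) + (1 - p) * ln ((1 - s) / (1 - m))"

text \<open>The Kullback-Leibler divergence, in nats, between Bernoulli distributions.\<close>

definition rel_entropy :: "real \<Rightarrow> real \<Rightarrow> real" where
  "rel_entropy p q = log_gain p q p"

text \<open>A weak form of Pinsker's inequality through the squared Hellinger distance:
  \<open>ln z \<le> z - 1\<close> at \<open>z = sqrt (y / x)\<close> bounds each summand, and the
  linear terms of the two summands cancel.\<close>

lemma rel_entropy_ge:
  assumes "0 < p" "p < 1" "0 < q" "q < 1"
  shows "(p - q)\<^sup>2 / 2 \<le> rel_entropy p q"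
proof -
  have *: "x * ln (x / y) \<ge> (x - y) + (sqrt x - sqrt y)\<^sup>2" if "0 < x" "0 < y" for x y :: real
  proof -
    have "ln (sqrt (y / x)) \<le> sqrt (y / x) - 1" using that by (intro ln_le_minus_one) auto
    then have "ln (y / x) \<le> 2 * (sqrt (y / x) - 1)" using that by (simp add: ln_sqrt)
    then have "x * ln (y / x) \<le> x * (2 * (sqrt (y / x) - 1))" using that by (intro mult_left_mono) auto
    moreover have "x * sqrt (y / x) = sqrt x * sqrt y"
      using that by (simp add: real_sqrt_divide) (metis real_div_sqrt less_imp_le mult.commute times_divide_eq_right)
    moreover have "ln (y / x) = - ln (x / y)" using that by (simp add: ln_div)
    moreover have "(sqrt x - sqrt y)\<^sup>2 = x + y - 2 * (sqrt x * sqrt y)"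
      using that by (simp add: power2_eq_square algebra_simps)
    ultimately show ?thesis by (simp add: algebra_simps)
  qed
  have **: "(x - y)\<^sup>2 / 4 \<le> (sqrt x - sqrt y)\<^sup>2" if "0 < x" "x < 1" "0 < y" "y < 1" for x y :: real
  proof -
    have "(x - y)\<^sup>2 = (sqrt x - sqrt y)\<^sup>2 * (sqrt x + sqrt y)\<^sup>2"
    proof -
      have "x - y = (sqrt x - sqrt y) * (sqrt x + sqrt y)" using that by (simp add: algebra_simps)
      then show ?thesis by (simp add: power_mult_distrib)
    qed
    also have "\<dots> \<le> (sqrt x - sqrt y)\<^sup>2 * 2\<^sup>2"
    proof (intro mult_left_mono power_mono)
      have "sqrt x \<le> 1" "sqrt y \<le> 1" using that by auto
      then show "sqrt x + sqrt y \<le> 2" by linarith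
    qed (use that in auto)
    finally show ?thesis by simp
  qed
  have "(p - q)\<^sup>2 / 2 = (p - q)\<^sup>2 / 4 + ((1 - p) - (1 - q))\<^sup>2 / 4"
    by (simp add: power2_eq_square field_simps)
  also have "\<dots> \<le> (sqrt p - sqrt q)\<^sup>2 + (sqrt (1 - p) - sqrt (1 - q))\<^sup>2"
    using assms by (intro add_mono **) auto
  also have "\<dots> \<le> rel_entropy p q"
    unfolding rel_entropy_def log_gain_def using *[of p q] *[of "1 - p" "1 - q"] assms by simp
  finally show ?thesis .
qed

text \<open>The bound by the chi-squared divergence, again from
  \<open>ln z \<le> z - 1\<close>.\<close>

lemma rel_entropy_le:
  assumes "0 < p" "p < 1" "0 < q" "q < 1"
  shows "rel_entropy p q \<le> (p - q)\<^sup>2 / (q * (1 - q))"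
proof -
  have "p * ln (p / q) + (1 - p) * ln ((1 - p) / (1 - q))
      \<le> p * (p / q - 1) + (1 - p) * ((1 - p) / (1 - q) - 1)"
    using assms by (intro add_mono mult_left_mono ln_le_minus_one) auto
  also have "\<dots> = (p - q)\<^sup>2 / (q * (1 - q))"
    using assms by (simp add: divide_simps) (simp add: power2_eq_square algebra_simps)
  finally show ?thesis by (simp add: rel_entropy_def log_gain_def)
qed

text \<open>The compensation identity for mutual information with reference bias \<open>m\<close>.
  At a balance point the first two terms no longer depend on \<open>q\<close>, which makes the
  maximisation explicit.\<close>

lemma bac_information_log_gain:
  assumes "0 < a" "a < 1" "0 < b" "b < 1" "a = \<tau> - \<epsilon>" "b = \<tau> + \<epsilon>"
    and m: "0 < m" "m < 1" and q: "q \<in> {0..1}"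
    and \<mu>: "\<mu> = (1 - q) * a + q * b"
  shows "ln 2 * bac_information \<tau> \<epsilon> q =
    (1 - q) * rel_entropy a m + q * rel_entropy b m - rel_entropy \<mu> m"
proof -
  have "\<mu> > 0"
  proof (cases "q = 0")
    case False
    then have "0 < q * b" "0 \<le> (1 - q) * a" using q assms by auto
    then show ?thesis using \<mu> by linarith
  qed (use \<mu> assms in auto)
  have "1 - \<mu> = (1 - q) * (1 - a) + q * (1 - b)" by (simp add: \<mu> algebra_simps)
  moreover have "(1 - q) * (1 - a) + q * (1 - b) > 0"
  proof (cases "q = 0")
    case False
    then have "0 < q * (1 - b)" "0 \<le> (1 - q) * (1 - a)" using q assms by auto
    then show ?thesis by linarith
  qed (use assms in auto)
  ultimately have "1 - \<mu> > 0" by simp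
  have H: "ln 2 * binary_entropy x = - x * ln x - (1 - x) * ln (1 - x)" for x
    by (simp add: binary_entropy_def log_def field_simps)
  have R: "rel_entropy x m = - (ln 2 * binary_entropy x) - x * ln m - (1 - x) * ln (1 - m)"
    if "0 < x" "0 < 1 - x" for x
    using that m unfolding H rel_entropy_def log_gain_def
    by (simp add: ln_div algebra_simps)
  have "ln 2 * bac_information \<tau> \<epsilon> q = ln 2 * binary_entropy \<mu>
      - (1 - q) * (ln 2 * binary_entropy a) - q * (ln 2 * binary_entropy b)"
    unfolding bac_information_def \<mu> assms(5,6) by (simp add: algebra_simps)
  moreover have "\<mu> * ln m = (1 - q) * (a * ln m) + q * (b * ln m)"
    "(1 - \<mu>) * ln (1 - m) = (1 - q) * ((1 - a) * ln (1 - m)) + q * ((1 - b) * ln (1 - m))"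
    by (simp_all add: \<mu> algebra_simps)
  moreover have "(1 - q) * rel_entropy a m = - ((1 - q) * (ln 2 * binary_entropy a))
      - (1 - q) * (a * ln m) - (1 - q) * ((1 - a) * ln (1 - m))"
    using R[of a] assms(1,2) by (simp add: right_diff_distrib)
  moreover have "q * rel_entropy b m = - (q * (ln 2 * binary_entropy b))
      - q * (b * ln m) - q * ((1 - b) * ln (1 - m))"
    using R[of b] assms(3,4) by (simp add: right_diff_distrib)
  ultimately show ?thesis using R[OF \<open>\<mu> > 0\<close> \<open>1 - \<mu> > 0\<close>] by linarith
qed

text \<open>Each divergence vanishes exactly at its own bias, so their difference changes sign
  between \<open>a\<close> and \<open>b\<close>.\<close>

lemma rel_entropy_balance_point:
  assumes "0 < a" "a < b" "b < 1"
  obtains m where "a < m" "m < b" "rel_entropy a m = rel_entropy b m"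
proof -
  define f where "f x = rel_entropy a x - rel_entropy b x" for x
  have self: "rel_entropy x x = 0" if "0 < x" "x < 1" for x
    using that by (simp add: rel_entropy_def log_gain_def)
  have pos: "0 < rel_entropy x y" if "0 < x" "x < 1" "0 < y" "y < 1" "x \<noteq> y" for x y
    using rel_entropy_ge[of x y] that by (smt (verit) zero_less_power2 half_gt_zero)
  have "f a < 0" "0 < f b"
    using self[of a] self[of b] pos[of a b] pos[of b a] assms by (auto simp: f_def)
  moreover have "continuous_on {a..b} f"
    unfolding f_def rel_entropy_def log_gain_def
    by (intro continuous_intros) (use assms in auto)
  ultimately obtain m where m: "a \<le> m" "m \<le> b" "f m = 0"
    using IVT'[of f a 0 b] assms by force
  moreover have "m \<noteq> a" "m \<noteq> b" using m \<open>f a < 0\<close> \<open>0 < f b\<close> by auto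
  ultimately show ?thesis using that[of m] by (auto simp: f_def)
qed

text \<open>The number \<open>u\<close> is later computed from \<open>\<tau>\<close> alone. It keeps
  \<open>\<tau> - \<epsilon>\<close> and \<open>\<tau> + \<epsilon>\<close> at distance
  \<open>u\<close> from 0 and 1, so constants expressed through \<open>u\<close> are uniform in
  \<open>\<epsilon>\<close>.\<close>

locale balanced_channel =
  fixes \<tau> \<epsilon> m c u :: real
  assumes eps: "0 < \<epsilon>" "\<epsilon> < u"
    and tau: "2 * u \<le> \<tau>" "2 * u \<le> 1 - \<tau>"
    and m: "\<tau> - \<epsilon> < m" "m < \<tau> + \<epsilon>"
    and balanced: "rel_entropy (\<tau> - \<epsilon>) m = c" "rel_entropy (\<tau> + \<epsilon>) m = c"
begin

lemma u: "0 < u" "u \<le> 1/4"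
  using eps tau by auto

lemma in_range:
  assumes "\<tau> - \<epsilon> \<le> s" "s \<le> \<tau> + \<epsilon>"
  shows "u \<le> s" "u \<le> 1 - s" "0 < s" "s < 1"
  using assms eps tau u by linarith+

lemma variance_ge:
  assumes "\<tau> - \<epsilon> \<le> s" "s \<le> \<tau> + \<epsilon>"
  shows "u / 2 \<le> s * (1 - s)"
proof (cases "s \<le> 1/2")
  case True
  have "u * (1/2) \<le> s * (1 - s)" using True in_range[OF assms] u by (intro mult_mono) auto
  then show ?thesis by simp
next
  case False
  have "(1/2) * u \<le> s * (1 - s)" using False in_range[OF assms] u by (intro mult_mono) auto
  then show ?thesis by simp
qed

text \<open>At least one end is at distance \<open>\<epsilon>\<close> or more from \<open>m\<close>,
  and \<open>c\<close> is the divergence from either end. With \<open>c_le\<close> this shows that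
  \<open>c\<close> is of order \<open>\<epsilon>\<^sup>2\<close>, so errors of that order can be
  charged to \<open>c\<close>.\<close>

lemma c_ge: "\<epsilon>\<^sup>2 / 2 \<le> c"
proof -
  have r: "0 < \<tau> - \<epsilon>" "\<tau> + \<epsilon> < 1" "0 < m" "m < 1" "0 < \<tau> + \<epsilon>" "\<tau> - \<epsilon> < 1"
    using in_range[of m] in_range[of "\<tau> - \<epsilon>"] in_range[of "\<tau> + \<epsilon>"] m eps by auto
  show ?thesis
  proof (cases "\<tau> \<le> m")
    case True
    have "\<epsilon>\<^sup>2 \<le> (m - (\<tau> - \<epsilon>))\<^sup>2" using True eps by (intro power_mono) auto
    then show ?thesis using rel_entropy_ge[of "\<tau> - \<epsilon>" m] r balanced
      by (simp add: power2_commute)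
  next
    case False
    have "\<epsilon>\<^sup>2 \<le> (\<tau> + \<epsilon> - m)\<^sup>2" using False eps by (intro power_mono) auto
    then show ?thesis using rel_entropy_ge[of "\<tau> + \<epsilon>" m] r balanced by simp
  qed
qed

lemma c_pos: "0 < c"
  using c_ge eps by (smt (verit) zero_less_power half_gt_zero)

lemma c_le: "c \<le> 8 * \<epsilon>\<^sup>2 / u"
proof -
  have "c \<le> (\<tau> + \<epsilon> - m)\<^sup>2 / (m * (1 - m))"
    using rel_entropy_le[of "\<tau> + \<epsilon>" m] in_range[of m] in_range[of "\<tau> + \<epsilon>"] m eps balanced by auto
  also have "\<dots> \<le> (2 * \<epsilon>)\<^sup>2 / (u / 2)"
    using variance_ge[of m] m eps u by (intro frac_le power_mono) auto
  also have "\<dots> = 8 * \<epsilon>\<^sup>2 / u" by (simp add: power2_eq_square)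
  finally show ?thesis .
qed

text \<open>By the compensation identity every input loses a nonnegative divergence from
  \<open>c\<close>; the \<open>q\<close> whose mixture is \<open>m\<close> loses nothing.\<close>

lemma capacity: "bac_capacity \<tau> \<epsilon> = c / ln 2"
proof -
  define q where "q = (m - (\<tau> - \<epsilon>)) / (2 * \<epsilon>)"
  have q: "q \<in> {0..1}" using m eps by (auto simp: q_def field_simps)
  have r: "0 < \<tau> - \<epsilon>" "\<tau> + \<epsilon> < 1" "0 < m" "m < 1" "0 < \<tau> + \<epsilon>" "\<tau> - \<epsilon> < 1"
    using in_range[of m] in_range[of "\<tau> - \<epsilon>"] in_range[of "\<tau> + \<epsilon>"] m eps by auto
  have inf: "ln 2 * bac_information \<tau> \<epsilon> r =
      c - rel_entropy ((1 - r) * (\<tau> - \<epsilon>) + r * (\<tau> + \<epsilon>)) m" if "r \<in> {0..1}" for r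
    using bac_information_log_gain[of "\<tau> - \<epsilon>" "\<tau> + \<epsilon>" \<tau> \<epsilon> m r, OF _ _ _ _ refl refl _ _ that refl]
      r balanced by (simp add: algebra_simps)
  have "(1 - q) * (\<tau> - \<epsilon>) + q * (\<tau> + \<epsilon>) = m"
    using eps by (simp add: q_def field_simps)
  then have "ln 2 * bac_information \<tau> \<epsilon> q = c"
    using inf[OF q] r by (simp add: rel_entropy_def log_gain_def)
  then have 1: "bac_information \<tau> \<epsilon> q = c / ln 2" by (simp add: field_simps)
  have 2: "bac_information \<tau> \<epsilon> r' \<le> c / ln 2" if "r' \<in> {0..1}" for r'
  proof -
    define \<mu> where "\<mu> = (1 - r') * (\<tau> - \<epsilon>) + r' * (\<tau> + \<epsilon>)"
    have \<mu>: "\<mu> = \<tau> - \<epsilon> + r' * (2 * \<epsilon>)" by (simp add: \<mu>_def algebra_simps)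
    have "0 \<le> r' * (2 * \<epsilon>)" "r' * (2 * \<epsilon>) \<le> 1 * (2 * \<epsilon>)"
      using that eps by (auto intro!: mult_right_mono)
    then have "0 < \<mu>" "\<mu> < 1" using \<mu> r by linarith+
    then have "0 \<le> rel_entropy \<mu> m" using rel_entropy_ge[of \<mu> m] r
      by (meson order_trans zero_le_power2 half_gt_zero divide_nonneg_nonneg zero_le_numeral)
    then have "ln 2 * bac_information \<tau> \<epsilon> r' \<le> c" using inf[OF that] by (simp add: \<mu>_def)
    then show ?thesis by (simp add: field_simps)
  qed
  show ?thesis unfolding bac_capacity_def
    using 1 2 q by (intro cSup_eq_maximum) (auto simp: image_iff intro!: bexI[of _ q])
qed

lemma abs_ln_ratio_le:
  assumes "\<tau> - \<epsilon> \<le> s" "s \<le> \<tau> + \<epsilon>"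
  shows "\<bar>ln (s / m)\<bar> \<le> 2 * \<epsilon> / u" "\<bar>ln ((1 - s) / (1 - m))\<bar> \<le> 2 * \<epsilon> / u"
proof -
  have *: "\<bar>ln (x / y)\<bar> \<le> 2 * \<epsilon> / u" if "u \<le> x" "u \<le> y" "\<bar>x - y\<bar> \<le> 2 * \<epsilon>" for x y :: real
  proof -
    have pos: "0 < x" "0 < y" using that u by auto
    have "ln (x / y) \<le> x / y - 1" "ln (y / x) \<le> y / x - 1"
      using pos by (auto intro!: ln_le_minus_one)
    moreover have "x / y - 1 = (x - y) / y" "y / x - 1 = (y - x) / x" using pos by (auto simp: field_simps)
    moreover have "(x - y) / y \<le> 2 * \<epsilon> / u" "(y - x) / x \<le> 2 * \<epsilon> / u"
      using that u eps by (auto intro!: frac_le)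
    moreover have "ln (y / x) = - ln (x / y)" using pos by (simp add: ln_div)
    ultimately show ?thesis by linarith
  qed
  have "u \<le> s" "u \<le> 1 - s" "u \<le> m" "u \<le> 1 - m" using in_range[OF assms] in_range[of m] m by auto
  then show "\<bar>ln (s / m)\<bar> \<le> 2 * \<epsilon> / u" "\<bar>ln ((1 - s) / (1 - m))\<bar> \<le> 2 * \<epsilon> / u"
    using assms m by (auto intro!: *)
qed

text \<open>The gain is affine in \<open>p\<close> and equals \<open>c\<close> at
  \<open>p = s\<close>. Moving outwards only helps; moving inwards by
  \<open>\<eta> * \<epsilon>\<close> costs at most that times the slope
  \<open>4 * \<epsilon> / u\<close>, which \<open>c_ge\<close> turns into a multiple of
  \<open>\<eta> * c\<close>.\<close>

lemma log_gain_far: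
  assumes "0 \<le> \<eta>"
  shows "\<tau> + \<epsilon> - \<eta> * \<epsilon> \<le> p \<Longrightarrow> c - 8 / u * \<eta> * c \<le> log_gain (\<tau> + \<epsilon>) m p"
    and "p \<le> \<tau> - \<epsilon> + \<eta> * \<epsilon> \<Longrightarrow> c - 8 / u * \<eta> * c \<le> log_gain (\<tau> - \<epsilon>) m p"
proof -
  have r: "0 < m" "m < 1" "0 < \<tau> - \<epsilon>" "\<tau> + \<epsilon> < 1"
    using in_range[of m] in_range[of "\<tau> - \<epsilon>"] in_range[of "\<tau> + \<epsilon>"] m eps by auto
  have lin: "log_gain s m p = rel_entropy s m + (p - s) * (ln (s / m) - ln ((1 - s) / (1 - m)))" for s p
    by (simp add: rel_entropy_def log_gain_def algebra_simps)
  have e: "\<eta> * \<epsilon> * (4 * \<epsilon> / u) \<le> 8 / u * \<eta> * c"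
  proof -
    have "\<eta> * \<epsilon> * (4 * \<epsilon> / u) = (8 / u * \<eta>) * (\<epsilon>\<^sup>2 / 2)" by (simp add: power2_eq_square)
    also have "\<dots> \<le> (8 / u * \<eta>) * c" using c_ge u assms by (intro mult_left_mono) auto
    finally show ?thesis .
  qed
  show "c - 8 / u * \<eta> * c \<le> log_gain (\<tau> + \<epsilon>) m p" if p: "\<tau> + \<epsilon> - \<eta> * \<epsilon> \<le> p"
  proof -
    define d where "d = ln ((\<tau> + \<epsilon>) / m) - ln ((1 - (\<tau> + \<epsilon>)) / (1 - m))"
    have "0 \<le> ln ((\<tau> + \<epsilon>) / m)" "ln ((1 - (\<tau> + \<epsilon>)) / (1 - m)) \<le> 0" using r m eps by auto
    then have d: "0 \<le> d" "d \<le> 4 * \<epsilon> / u"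
      using abs_ln_ratio_le[of "\<tau> + \<epsilon>"] eps unfolding d_def by auto
    have "- (\<eta> * \<epsilon>) * (4 * \<epsilon> / u) \<le> - (\<eta> * \<epsilon>) * d" using d assms eps by (intro mult_left_mono_neg) auto
    also have "\<dots> \<le> (p - (\<tau> + \<epsilon>)) * d" using p d by (intro mult_right_mono) auto
    finally show ?thesis using lin[where s = "\<tau> + \<epsilon>" and p = p] balanced e unfolding d_def by simp
  qed
  show "c - 8 / u * \<eta> * c \<le> log_gain (\<tau> - \<epsilon>) m p" if p: "p \<le> \<tau> - \<epsilon> + \<eta> * \<epsilon>"
  proof -
    define d where "d = ln ((1 - (\<tau> - \<epsilon>)) / (1 - m)) - ln ((\<tau> - \<epsilon>) / m)"
    have "ln ((\<tau> - \<epsilon>) / m) \<le> 0" "0 \<le> ln ((1 - (\<tau> - \<epsilon>)) / (1 - m))" using r m eps by auto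
    then have d: "0 \<le> d" "d \<le> 4 * \<epsilon> / u"
      using abs_ln_ratio_le[of "\<tau> - \<epsilon>"] eps unfolding d_def by auto
    have "- (\<eta> * \<epsilon>) * (4 * \<epsilon> / u) \<le> - (\<eta> * \<epsilon>) * d" using d assms eps by (intro mult_left_mono_neg) auto
    also have "\<dots> \<le> ((\<tau> - \<epsilon>) - p) * d" using p d by (intro mult_right_mono) auto
    also have "\<dots> = (p - (\<tau> - \<epsilon>)) * (- d)" by (simp add: algebra_simps)
    finally show ?thesis using lin[where s = "\<tau> - \<epsilon>" and p = p] balanced e unfolding d_def by simp
  qed
qed

text \<open>On the given side the gain is smallest at \<open>p = \<tau>\<close>, where it is a
  difference of two divergences from \<open>\<tau>\<close>; the negative one is of order
  \<open>\<epsilon>\<^sup>2\<close>.\<close>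

lemma log_gain_near:
  assumes s: "\<tau> - \<epsilon> \<le> s" "s \<le> \<tau> + \<epsilon>" and side: "(s \<le> m \<and> p \<le> \<tau>) \<or> (m \<le> s \<and> \<tau> \<le> p)"
  shows "- (4 / u) * c \<le> log_gain s m p"
proof -
  have r: "0 < m" "m < 1" "0 < s" "s < 1" "0 < \<tau>" "\<tau> < 1"
    using in_range[of m] in_range[OF s] in_range[of \<tau>] m eps by auto
  have "rel_entropy \<tau> s \<le> (\<tau> - s)\<^sup>2 / (s * (1 - s))" using rel_entropy_le[of \<tau> s] r by auto
  also have "\<dots> \<le> \<epsilon>\<^sup>2 / (u / 2)"
  proof (intro frac_le)
    show "(\<tau> - s)\<^sup>2 \<le> \<epsilon>\<^sup>2" using s eps by (simp add: abs_le_square_iff[symmetric])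
  qed (use variance_ge[OF s] u in auto)
  also have "\<dots> = (4 / u) * (\<epsilon>\<^sup>2 / 2)" by simp
  also have "\<dots> \<le> (4 / u) * c" using c_ge u by (intro mult_left_mono) auto
  finally have "rel_entropy \<tau> s \<le> (4 / u) * c" .
  moreover have "0 \<le> rel_entropy \<tau> m" using rel_entropy_ge[of \<tau> m] r
    by (meson order_trans zero_le_power2 divide_nonneg_nonneg zero_le_numeral)
  moreover have "log_gain s m \<tau> = rel_entropy \<tau> m - rel_entropy \<tau> s"
    unfolding rel_entropy_def log_gain_def using r by (simp add: ln_div algebra_simps)
  moreover have "log_gain s m \<tau> \<le> log_gain s m p"
  proof -
    have "log_gain s m p = log_gain s m \<tau> + (p - \<tau>) * (ln (s / m) - ln ((1 - s) / (1 - m)))"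
      by (simp add: log_gain_def algebra_simps)
    moreover have "0 \<le> (p - \<tau>) * (ln (s / m) - ln ((1 - s) / (1 - m)))"
      using side
    proof
      assume "s \<le> m \<and> p \<le> \<tau>"
      moreover from this have "ln (s / m) \<le> 0" "0 \<le> ln ((1 - s) / (1 - m))" using r by auto
      ultimately show ?thesis by (intro mult_nonpos_nonpos) auto
    next
      assume "m \<le> s \<and> \<tau> \<le> p"
      moreover from this have "0 \<le> ln (s / m)" "ln ((1 - s) / (1 - m)) \<le> 0" using r by auto
      ultimately show ?thesis by (intro mult_nonneg_nonneg) auto
    qed
    ultimately show ?thesis by linarith
  qed
  ultimately show ?thesis by linarith
qed

text \<open>One step of the exponential supermartingale: the left side is the expected factor on a
  weight raised to the power \<open>- \<eta>\<close>. Squared log-increments are of order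
  \<open>\<epsilon>\<^sup>2\<close>, hence of order \<open>c\<close>.\<close>

lemma weight_moment_le:
  assumes s: "\<tau> - \<epsilon> \<le> s" "s \<le> \<tau> + \<epsilon>" and p: "0 \<le> p" "p \<le> 1" and \<eta>: "0 \<le> \<eta>" "\<eta> \<le> 1/2"
  shows "p * exp (- \<eta> * ln (s / m)) + (1 - p) * exp (- \<eta> * ln ((1 - s) / (1 - m)))
    \<le> exp (- \<eta> * (log_gain s m p - 8 / u\<^sup>2 * \<eta> * c))"
proof -
  have B: "2 * \<epsilon> / u \<le> 2" using eps u by (simp add: field_simps)
  have sq: "(- \<eta> * x)\<^sup>2 \<le> \<eta> * (8 / u\<^sup>2 * \<eta> * c)" and ab: "\<bar>- \<eta> * x\<bar> \<le> 1"
    if "\<bar>x\<bar> \<le> 2 * \<epsilon> / u" for x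
  proof -
    have "x\<^sup>2 \<le> (2 * \<epsilon> / u)\<^sup>2" using that abs_le_square_iff[of x "2 * \<epsilon> / u"] eps u by simp
    also have "\<dots> = 8 / u\<^sup>2 * (\<epsilon>\<^sup>2 / 2)" by (simp add: power2_eq_square)
    also have "\<dots> \<le> 8 / u\<^sup>2 * c" using c_ge u by (intro mult_left_mono) auto
    finally have "\<eta>\<^sup>2 * x\<^sup>2 \<le> \<eta>\<^sup>2 * (8 / u\<^sup>2 * c)" by (intro mult_left_mono) auto
    then show "(- \<eta> * x)\<^sup>2 \<le> \<eta> * (8 / u\<^sup>2 * \<eta> * c)" by (simp add: power2_eq_square algebra_simps)
    have "\<eta> * \<bar>x\<bar> \<le> (1/2) * 2" using \<eta> that B by (intro mult_mono) auto
    then show "\<bar>- \<eta> * x\<bar> \<le> 1" using \<eta> by (simp add: abs_mult)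
  qed
  have "p * exp (- \<eta> * ln (s / m)) + (1 - p) * exp (- \<eta> * ln ((1 - s) / (1 - m)))
    \<le> exp (p * (- \<eta> * ln (s / m)) + (1 - p) * (- \<eta> * ln ((1 - s) / (1 - m))) + \<eta> * (8 / u\<^sup>2 * \<eta> * c))"
    using p abs_ln_ratio_le[OF s] by (intro two_point_mgf_le sq ab) auto
  also have "p * (- \<eta> * ln (s / m)) + (1 - p) * (- \<eta> * ln ((1 - s) / (1 - m))) + \<eta> * (8 / u\<^sup>2 * \<eta> * c)
    = - \<eta> * (log_gain s m p - 8 / u\<^sup>2 * \<eta> * c)"
    by (simp add: log_gain_def algebra_simps)
  finally show ?thesis .
qed

end

section \<open>Screening a list of intervals\<close>

text \<open>Here \<open>l\<close> is the last candidate judged low. A linear scan is affordable: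
  with about \<open>1 / \<eta>\<close> candidates its cost stays within the order of the one
  accurate test that ends it.\<close>

fun scan :: "nat \<Rightarrow> nat \<Rightarrow> real \<Rightarrow> real \<Rightarrow> nat \<Rightarrow> nat list \<Rightarrow> search_tree" where
  "scan M N \<theta> \<rho> l [] = Output l"
| "scan M N \<theta> \<rho> l (x # xs) = threshold_test x M (M * \<theta>) (scan M N \<theta> \<rho> x xs)
     (threshold_test (Suc l) N (N * \<rho>) (Output x) (Output l))"

lemma max_queries_scan: "max_queries (scan M N \<theta> \<rho> l xs) \<le> length xs * M + N"
proof (induction xs arbitrary: l)
  case (Cons x xs)
  have "max_queries (scan M N \<theta> \<rho> l (x # xs)) \<le> M + max (length xs * M + N) N"
    using Cons[of x] max_queries_threshold_test[of "Suc l" N "N * \<rho>" "Output x" "Output l"]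
      max_queries_threshold_test[of x M "M * \<theta>" "scan M N \<theta> \<rho> x xs"
        "threshold_test (Suc l) N (N * \<rho>) (Output x) (Output l)"]
    by (auto simp: max_def split: if_splits)
  then show ?case by simp
qed auto

text \<open>When the scan stops between \<open>l\<close> and \<open>x\<close>, a candidate with margin lies at or before \<open>l\<close>, and
  then \<open>l\<close> straddles, or at or after \<open>x\<close>, and then \<open>x\<close> does; one accurate test of coin \<open>l + 1\<close>
  tells which.\<close>

lemma miss_prob_scan:
  assumes p: "\<And>i. 0 \<le> p i" "\<And>i. p i \<le> 1" and mono: "mono p"
    and \<epsilon>: "0 < \<epsilon>" "\<epsilon> \<le> 1" and \<gamma>: "0 \<le> \<gamma>" "\<gamma> \<le> 1"
    and l: "sorted (l # xs)" "p l < \<tau> + \<epsilon>"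
      "\<tau> - \<epsilon> + \<gamma> < p (Suc l) \<or> (\<exists>x\<in>set xs. straddles \<tau> (\<epsilon> - \<gamma>) p x)"
  shows "miss_prob p {j. straddles \<tau> \<epsilon> p j} (scan M N \<tau> (\<tau> - \<epsilon> + \<gamma> / 2) l xs)
    \<le> length xs * exp (- (M * \<epsilon>\<^sup>2 / 4)) + exp (- (N * (\<gamma> / 2)\<^sup>2 / 4))"
  using l
proof (induction xs arbitrary: l)
  case Nil
  then show ?case using \<gamma> by (simp add: straddles_def)
next
  case (Cons x xs)
  define S where "S = {j. straddles \<tau> \<epsilon> p j}"
  define ec where "ec = exp (- (M * \<epsilon>\<^sup>2 / 4))"
  define ef where "ef = exp (- (N * (\<gamma> / 2)\<^sup>2 / 4))"
  define tH where "tH = threshold_test (Suc l) N (N * (\<tau> - \<epsilon> + \<gamma> / 2)) (Output x) (Output l)"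
  define tL where "tL = scan M N \<tau> (\<tau> - \<epsilon> + \<gamma> / 2) x xs"
  have pm: "p i \<le> p j" if "i \<le> j" for i j using mono that by (rule monoD)
  have e: "0 \<le> ec" "0 \<le> ef" by (auto simp: ec_def ef_def)
  have "l \<le> x" using Cons.prems(1) by simp
  have L: "miss_prob p S tL \<le> length xs * ec + ef" if "p x < \<tau> + \<epsilon>"
    unfolding tL_def S_def ec_def ef_def
  proof (rule Cons.IH)
    show "sorted (x # xs)" using Cons.prems(1) by simp
    show "p x < \<tau> + \<epsilon>" by fact
    \<comment> \<open>If the candidate with margin is \<open>x\<close> itself, its right end gives
      the first alternative.\<close>
    show "\<tau> - \<epsilon> + \<gamma> < p (Suc x) \<or> (\<exists>x\<in>set xs. straddles \<tau> (\<epsilon> - \<gamma>) p x)"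
      using Cons.prems(3) pm[of "Suc l" "Suc x"] \<open>l \<le> x\<close> by (auto simp: straddles_def)
  qed
  have H: "miss_prob p S tH \<le> ef" if "\<tau> - \<epsilon> < p x"
  proof -
    have xin: "x \<in> S" if nl: "\<not> \<tau> - \<epsilon> + \<gamma> < p (Suc l)"
    proof -
      obtain y where y: "y \<in> set (x # xs)" "straddles \<tau> (\<epsilon> - \<gamma>) p y" using Cons.prems(3) nl by blast
      have "p x \<le> p y" using y(1) Cons.prems(1) by (intro pm) auto
      then show ?thesis using y(2) \<open>\<tau> - \<epsilon> < p x\<close> pm[of x "Suc x"] \<gamma> by (auto simp: S_def straddles_def)
    qed
    have lin: "l \<in> S" if "\<tau> - \<epsilon> < p (Suc l)"
      using that Cons.prems(2) by (simp add: S_def straddles_def)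
    \<comment> \<open>The threshold is the middle of a band of width \<open>\<gamma>\<close>. Below
      the band \<open>x\<close> is a right answer and the test favours it, above it the same holds
      for \<open>l\<close>, and inside both answers are right.\<close>
    consider "p (Suc l) \<le> \<tau> - \<epsilon>" | "\<tau> - \<epsilon> < p (Suc l)" "p (Suc l) \<le> \<tau> - \<epsilon> + \<gamma>"
      | "\<tau> - \<epsilon> + \<gamma> < p (Suc l)" by linarith
    then show ?thesis
    proof cases
      case 1
      then have "miss_prob p S tH \<le> 0 + ef" unfolding tH_def ef_def
        using xin p \<gamma> by (intro miss_prob_threshold_test_low) auto
      then show ?thesis by simp
    next
      case 2
      then show ?thesis unfolding tH_def using xin lin e p by (intro miss_prob_threshold_test_le) auto
    next
      case 3
      then have "miss_prob p S tH \<le> 0 + ef" unfolding tH_def ef_def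
        using lin p \<gamma> by (intro miss_prob_threshold_test_high) auto
      then show ?thesis by simp
    qed
  qed
  \<comment> \<open>Within \<open>\<epsilon>\<close> of \<open>\<tau>\<close> either verdict of the
    crude test is acceptable; elsewhere the wrong one adds only \<open>ec\<close>.\<close>
  have "miss_prob p S (threshold_test x M (M * \<tau>) tL tH) \<le> length xs * ec + ef + ec"
  proof (cases "p x < \<tau> + \<epsilon> \<and> \<tau> - \<epsilon> < p x")
    case True
    have "0 \<le> length xs * ec" using e by simp
    then have "miss_prob p S tL \<le> length xs * ec + ef + ec" "miss_prob p S tH \<le> length xs * ec + ef + ec"
      using L H True e by linarith+
    then show ?thesis using p by (intro miss_prob_threshold_test_le)
  next
    case False
    then consider "p x \<le> \<tau> - \<epsilon>" | "\<tau> + \<epsilon> \<le> p x" by linarith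
    then show ?thesis
    proof cases
      case 1
      then show ?thesis unfolding ec_def[symmetric] using L e p \<epsilon>
        using miss_prob_threshold_test_low[of p S tL "length xs * ec + ef" \<epsilon> x \<tau> M tH]
        by (simp add: ec_def)
    next
      case 2
      have "0 \<le> length xs * ec" using e by simp
      then have "miss_prob p S tH \<le> length xs * ec + ef" using H 2 \<epsilon> by auto
      then show ?thesis using 2 e p \<epsilon>
        using miss_prob_threshold_test_high[of p S tH "length xs * ec + ef" \<epsilon> \<tau> x M tL]
        by (simp add: ec_def)
    qed
  qed
  then show ?case unfolding S_def tL_def tH_def ec_def ef_def by (simp add: algebra_simps)
qed

section \<open>Order statistics of the visited intervals\<close>

definition every_nth :: "nat \<Rightarrow> nat list \<Rightarrow> nat list" where
  "every_nth g xs = map (\<lambda>k. sort xs ! (k * g + (g - 1))) [0..<length xs div g]"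

lemma length_every_nth: "length (every_nth g xs) = length xs div g"
  by (simp add: every_nth_def)

lemma every_nth_index_less:
  fixes g k l :: nat
  assumes "0 < g" "k < l div g"
  shows "k * g + (g - 1) < l"
proof -
  have "Suc k * g \<le> (l div g) * g" using assms by (intro mult_right_mono) auto
  also have "\<dots> \<le> l" by simp
  finally show ?thesis using assms by simp
qed

lemma sorted_every_nth:
  assumes "0 < g"
  shows "sorted (every_nth g xs)"
  unfolding sorted_iff_nth_mono
proof (intro allI impI)
  fix i j assume ij: "i \<le> j" "j < length (every_nth g xs)"
  then have "j < length xs div g" "i < length xs div g" by (auto simp: every_nth_def)
  moreover have "i * g + (g - 1) \<le> j * g + (g - 1)" using ij by simp
  ultimately show "every_nth g xs ! i \<le> every_nth g xs ! j"
    using every_nth_index_less[OF assms, of j "length xs"]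
    by (simp add: every_nth_def sorted_nth_mono)
qed

text \<open>After sorting, the entries satisfying \<open>Q\<close> occupy at least \<open>g\<close>
  consecutive positions, and any \<open>g\<close> consecutive positions, counted from 0, include one
  congruent to \<open>g - 1\<close> modulo \<open>g\<close>.\<close>

lemma every_nth_meets_convex:
  assumes g: "0 < g" "g \<le> length (filter Q xs)"
    and conv: "\<And>x y z. x \<le> y \<Longrightarrow> y \<le> z \<Longrightarrow> Q x \<Longrightarrow> Q z \<Longrightarrow> Q y"
  shows "\<exists>x\<in>set (every_nth g xs). Q x"
proof -
  define ys where "ys = sort xs"
  define I where "I = {i. i < length ys \<and> Q (ys ! i)}"
  have "length (filter Q ys) = length (filter Q xs)"
    unfolding ys_def by (metis mset_filter mset_sort size_mset)
  then have card: "g \<le> card I" using g by (simp add: I_def length_filter_conv_card)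
  have fin: "finite I" by (simp add: I_def)
  then have ne: "I \<noteq> {}" using card g by auto
  define i where "i = Min I"
  have i: "i \<in> I" "\<And>j. j \<in> I \<Longrightarrow> i \<le> j" unfolding i_def using fin ne by auto
  define k where "k = i div g"
  \<comment> \<open>The first selected position at or after \<open>i\<close>; fewer than
    \<open>g\<close> positions lie in between, so some element of \<open>I\<close> is at or beyond
    it.\<close>
  define r where "r = k * g + (g - 1)"
  have "i = k * g + i mod g" by (simp add: k_def)
  moreover have "i mod g < g" using g by simp
  ultimately have r: "i \<le> r" "r < i + g" unfolding r_def using g by linarith+
  have "\<not> I \<subseteq> {i..<r}"
  proof
    assume "I \<subseteq> {i..<r}"
    then have "card I \<le> card {i..<r}" by (intro card_mono) auto
    then show False using card r by simp
  qed
  then obtain j where j: "j \<in> I" "r \<le> j" using i by fastforce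
  then have "r < length ys" by (auto simp: I_def)
  moreover have "Q (ys ! r)"
  proof (rule conv)
    show "ys ! i \<le> ys ! r" "ys ! r \<le> ys ! j"
      using r j \<open>r < length ys\<close> by (auto simp: I_def ys_def intro!: sorted_nth_mono)
  qed (use i j in \<open>auto simp: I_def\<close>)
  moreover have "k < length xs div g"
  proof -
    have "Suc k * g \<le> length xs" using \<open>r < length ys\<close> g by (simp add: r_def ys_def)
    then show ?thesis using g by (simp add: less_eq_div_iff_mult_less_eq Suc_le_eq[symmetric])
  qed
  ultimately show ?thesis by (auto simp: every_nth_def r_def ys_def intro!: bexI[of _ k])
qed

section \<open>Bayesian learning\<close>

text \<open>The predicted bias of a coin flipped at \<open>x\<close> if \<open>j\<close> is the
  sought interval. For \<open>j = x\<close> the value \<open>\<mu>\<close> interpolates between the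
  two ends, so that the overall prediction can be made exactly \<open>m\<close>.\<close>

definition likelihood :: "real \<Rightarrow> real \<Rightarrow> nat \<Rightarrow> real \<Rightarrow> nat \<Rightarrow> real" where
  "likelihood a b x \<mu> j = (if j < x then b else if j = x then \<mu> else a)"

definition is_split :: "real \<Rightarrow> real \<Rightarrow> real \<Rightarrow> nat \<Rightarrow> (nat \<Rightarrow> real) \<Rightarrow> nat \<times> real \<Rightarrow> bool" where
  "is_split a b m n w = (\<lambda>(x, \<mu>). a \<le> \<mu> \<and> \<mu> \<le> b \<and> (\<Sum>j\<le>n. w j * likelihood a b x \<mu> j) = m)"

definition split_point :: "real \<Rightarrow> real \<Rightarrow> real \<Rightarrow> nat \<Rightarrow> (nat \<Rightarrow> real) \<Rightarrow> nat \<times> real" where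
  "split_point a b m n w = (SOME z. is_split a b m n w z)"

text \<open>The prediction is \<open>a\<close> plus \<open>b - a\<close> times the posterior mass
  left of the split. So \<open>x\<close> is the quantile of order \<open>q\<close>, and
  \<open>\<mu>\<close> takes the fraction of \<open>w x\<close> still missing there.\<close>

lemma is_split_split_point:
  assumes w: "\<And>j. j \<le> n \<Longrightarrow> 0 \<le> w j" "(\<Sum>j\<le>n. w j) = 1" and ab: "a < m" "m < b"
  shows "is_split a b m n w (split_point a b m n w)"
proof -
  define q where "q = (m - a) / (b - a)"
  have q: "0 < q" "q < 1" "q * (b - a) = m - a" using ab by (auto simp: q_def)
  define P where "P k = (\<Sum>j<k. w j)" for k
  have PS: "P (Suc k) = P k + w k" for k by (simp add: P_def)
  have ex: "q \<le> P (Suc n)" using w(2) q by (simp add: P_def lessThan_Suc_atMost)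
  define x where "x = (LEAST k. q \<le> P (Suc k))"
  have x: "q \<le> P (Suc x)" "x \<le> n" unfolding x_def using ex by (auto intro: LeastI Least_le)
  have Px: "P x < q"
  proof (cases x)
    case 0
    then show ?thesis using q by (simp add: P_def)
  next
    case (Suc y)
    then have "y < x" by simp
    then show ?thesis using not_less_Least[of y "\<lambda>k. q \<le> P (Suc k)"] Suc by (simp add: x_def)
  qed
  have wx: "0 < w x" using x Px PS[of x] by linarith
  define \<mu> where "\<mu> = a + (b - a) * ((q - P x) / w x)"
  have f: "0 \<le> (q - P x) / w x" "(q - P x) / w x \<le> 1" using wx Px x PS[of x] by (auto simp: field_simps)
  have "a \<le> \<mu>" unfolding \<mu>_def using f ab mult_nonneg_nonneg[of "b - a" "(q - P x) / w x"] by linarith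
  moreover have "\<mu> \<le> b"
    using mult_left_mono[OF f(2), of "b - a"] ab by (simp add: \<mu>_def)
  moreover have "(\<Sum>j\<le>n. w j * likelihood a b x \<mu> j) = m"
  proof -
    have "(\<Sum>j\<le>n. w j * likelihood a b x \<mu> j)
      = (\<Sum>j\<le>n. a * w j + (if j < x then (b - a) * w j else 0) + (if j = x then (\<mu> - a) * w j else 0))"
      by (intro sum.cong) (auto simp: likelihood_def algebra_simps)
    also have "\<dots> = a * (\<Sum>j\<le>n. w j) + (\<Sum>j\<le>n. if j < x then (b - a) * w j else 0) + (\<mu> - a) * w x"
      using x by (simp add: sum.distrib sum_distrib_left)
    also have "(\<Sum>j\<le>n. if j < x then (b - a) * w j else 0) = (\<Sum>j<x. (b - a) * w j)"
      using x by (intro sum.mono_neutral_cong_right) auto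
    also have "\<dots> = (b - a) * P x" by (simp add: P_def sum_distrib_left)
    also have "(\<mu> - a) * w x = (b - a) * (q - P x)" using wx by (simp add: \<mu>_def)
    also have "a * (\<Sum>j\<le>n. w j) + (b - a) * P x + (b - a) * (q - P x) = m"
      using q(3) w(2) by (simp add: algebra_simps)
    finally show ?thesis .
  qed
  ultimately have "is_split a b m n w (x, \<mu>)" by (simp add: is_split_def)
  then show ?thesis unfolding split_point_def by (rule someI)
qed

text \<open>The end of \<open>x\<close> to flip is chosen so that, should \<open>x\<close> itself cross \<open>\<tau>\<close>, the bias of the
  flipped coin errs to the same side of \<open>\<tau>\<close> as \<open>\<mu>\<close> does of \<open>m\<close>.\<close>

fun learn :: "real \<Rightarrow> real \<Rightarrow> real \<Rightarrow> nat \<Rightarrow> (nat list \<Rightarrow> search_tree) \<Rightarrow> nat \<Rightarrow> (nat \<Rightarrow> real) \<Rightarrow>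
    nat list \<Rightarrow> search_tree" where
  "learn a b m n k 0 w xs = k xs"
| "learn a b m n k (Suc t) w xs = (case split_point a b m n w of (x, \<mu>) \<Rightarrow>
     Flip (if \<mu> \<le> m then x else Suc x)
       (learn a b m n k t (\<lambda>j. w j * ((1 - likelihood a b x \<mu> j) / (1 - m))) (x # xs))
       (learn a b m n k t (\<lambda>j. w j * (likelihood a b x \<mu> j / m)) (x # xs)))"

lemma max_queries_learn:
  assumes "\<And>ys. length ys = t + length xs \<Longrightarrow> max_queries (k ys) \<le> q"
  shows "max_queries (learn a b m n k t w xs) \<le> t + q"
  using assms
proof (induction t arbitrary: w xs)
  case (Suc t)
  have "max_queries (learn a b m n k t w' (x # xs)) \<le> t + q" for w' x
    using Suc.prems by (intro Suc.IH) auto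
  then show ?case by (simp split: prod.split)
qed simp

context balanced_channel
begin

text \<open>The bound is \<open>w J\<close> to the power \<open>- \<eta>\<close>, discounted by a
  gain of \<open>c - \<Lambda> * \<eta> * c\<close> per remaining step, with
  \<open>\<Lambda> * c\<close> conceded for each visit to \<open>Q\<close> still missing. Averaging
  over the two results of a flip does not increase it. At a leaf with too few visits it is at least
  1, because a posterior weight is at most 1.\<close>

lemma miss_prob_learn:
  fixes \<eta> :: real and p :: "nat \<Rightarrow> real"
  defines "\<Lambda> \<equiv> 10 / u\<^sup>2"
  defines "Q \<equiv> straddles \<tau> (\<epsilon> - \<eta> * \<epsilon>) p"
  assumes p: "\<And>i. 0 \<le> p i" "\<And>i. p i \<le> 1" and mono: "mono p"
    and J: "p J \<le> \<tau>" "\<tau> \<le> p (Suc J)" "J \<le> n"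
    and \<eta>: "0 < \<eta>" "\<eta> \<le> 1/2"
    and k: "0 \<le> e" "\<And>ys. length ys = M \<Longrightarrow> g \<le> length (filter Q ys) \<Longrightarrow> miss_prob p S (k ys) \<le> e"
    and w: "\<And>j. j \<le> n \<Longrightarrow> 0 \<le> w j" "(\<Sum>j\<le>n. w j) = 1" "0 < w J"
    and M: "t + length xs = M"
  shows "miss_prob p S (learn (\<tau> - \<epsilon>) (\<tau> + \<epsilon>) m n k t w xs)
    \<le> e + exp (- \<eta> * ln (w J) - \<eta> * (t * (c - \<Lambda> * \<eta> * c) - \<Lambda> * c * (real g - length (filter Q xs))))"
  using w M
proof (induction t arbitrary: w xs)
  case 0
  show ?case
  proof (cases "g \<le> length (filter Q xs)")
    case True
    then have "miss_prob p S (k xs) \<le> e" using k 0 by simp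
    then show ?thesis by (simp add: add_increasing2)
  next
    case False
    have "w J \<le> (\<Sum>j\<le>n. w j)" using 0 J by (intro member_le_sum) auto
    then have "ln (w J) \<le> 0" using 0 by simp
    then have "0 \<le> - \<eta> * ln (w J)" using \<eta> by (simp add: mult_nonneg_nonpos)
    moreover have "0 \<le> \<eta> * (\<Lambda> * c * (real g - length (filter Q xs)))"
      using False c_pos \<eta> by (auto simp: \<Lambda>_def intro!: mult_nonneg_nonneg)
    ultimately have "1 \<le> exp (- \<eta> * ln (w J) - \<eta> * (real 0 * (c - \<Lambda> * \<eta> * c) - \<Lambda> * c * (real g - length (filter Q xs))))"
      by simp
    moreover have "miss_prob p S (k xs) \<le> 1" using p by (intro miss_prob_bounds)
    ultimately show ?thesis using k(1) by (simp only: learn.simps)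
  qed
next
  case (Suc t)
  define a b where "a = \<tau> - \<epsilon>" and "b = \<tau> + \<epsilon>"
  have pm: "p i \<le> p j" if "i \<le> j" for i j using mono that by (rule monoD)
  obtain x \<mu> where x: "split_point a b m n w = (x, \<mu>)" by (cases "split_point a b m n w")
  have sp: "is_split a b m n w (x, \<mu>)"
    unfolding x[symmetric] using Suc.prems m by (intro is_split_split_point) (auto simp: a_def b_def)
  define f where "f = likelihood a b x \<mu>"
  have f: "a \<le> f j" "f j \<le> b" for j using sp eps
    by (auto simp: f_def likelihood_def is_split_def a_def b_def)
  have sum_f: "(\<Sum>j\<le>n. w j * f j) = m" using sp by (simp add: is_split_def f_def)
  have fr: "0 < f j" "f j < 1" for j using in_range[of "f j"] f[of j] by (auto simp: a_def b_def)
  have mr: "0 < m" "m < 1" using in_range[of m] m by auto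
  define i where "i = (if \<mu> \<le> m then x else Suc x)"
  define s where "s = f J"
  have s: "\<tau> - \<epsilon> \<le> s" "s \<le> \<tau> + \<epsilon>" using f[of J] by (auto simp: s_def a_def b_def)
  define w0 w1 where "w0 j = w j * ((1 - f j) / (1 - m))" and "w1 j = w j * (f j / m)" for j
  define G where "G = real (length (filter Q (x # xs)))"
  define E where "E = exp (- \<eta> * ln (w J) - \<eta> * (t * (c - \<Lambda> * \<eta> * c) - \<Lambda> * c * (real g - G)))"
  have "miss_prob p S (learn a b m n k t w1 (x # xs))
      \<le> e + exp (- \<eta> * ln (w1 J) - \<eta> * (t * (c - \<Lambda> * \<eta> * c) - \<Lambda> * c * (real g - G)))"
    unfolding a_def b_def G_def
  proof (rule Suc.IH)
    \<comment> \<open>The posterior stays normalised because the predicted bias is exactly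
      \<open>m\<close>.\<close>
    show "(\<Sum>j\<le>n. w1 j) = 1"
      using sum_f mr by (simp add: w1_def sum_divide_distrib[symmetric])
  qed (use Suc.prems fr mr in \<open>auto simp: w1_def less_imp_le\<close>)
  also have "ln (w1 J) = ln (w J) + ln (s / m)"
    using Suc.prems fr[of J] mr unfolding w1_def s_def by (intro ln_mult_pos) auto
  finally have 1: "miss_prob p S (learn a b m n k t w1 (x # xs)) \<le> e + E * exp (- \<eta> * ln (s / m))"
    unfolding E_def mult_exp_exp by (simp add: algebra_simps)
  have "miss_prob p S (learn a b m n k t w0 (x # xs))
      \<le> e + exp (- \<eta> * ln (w0 J) - \<eta> * (t * (c - \<Lambda> * \<eta> * c) - \<Lambda> * c * (real g - G)))"
    unfolding a_def b_def G_def
  proof (rule Suc.IH)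
    have "(\<Sum>j\<le>n. w j * (1 - f j)) = 1 - m"
      using sum_f Suc.prems(2) by (simp add: right_diff_distrib sum_subtractf)
    then show "(\<Sum>j\<le>n. w0 j) = 1"
      using mr by (simp add: w0_def sum_divide_distrib[symmetric])
  qed (use Suc.prems fr mr in \<open>auto simp: w0_def less_imp_le\<close>)
  also have "ln (w0 J) = ln (w J) + ln ((1 - s) / (1 - m))"
    using Suc.prems fr[of J] mr unfolding w0_def s_def by (intro ln_mult_pos) auto
  finally have 0: "miss_prob p S (learn a b m n k t w0 (x # xs))
      \<le> e + E * exp (- \<eta> * ln ((1 - s) / (1 - m)))"
    unfolding E_def mult_exp_exp by (simp add: algebra_simps)
  have "miss_prob p S (learn a b m n k (Suc t) w xs)
      = p i * miss_prob p S (learn a b m n k t w1 (x # xs))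
        + (1 - p i) * miss_prob p S (learn a b m n k t w0 (x # xs))"
    by (simp add: x i_def w0_def[abs_def] w1_def[abs_def] f_def)
  also have "\<dots> \<le> p i * (e + E * exp (- \<eta> * ln (s / m))) + (1 - p i) * (e + E * exp (- \<eta> * ln ((1 - s) / (1 - m))))"
    using 0 1 p by (intro add_mono mult_left_mono) auto
  also have "\<dots> = e + E * (p i * exp (- \<eta> * ln (s / m)) + (1 - p i) * exp (- \<eta> * ln ((1 - s) / (1 - m))))"
    by (simp add: algebra_simps)
  also have "\<dots> \<le> e + E * exp (- \<eta> * (log_gain s m (p i) - 8 / u\<^sup>2 * \<eta> * c))"
    using weight_moment_le[OF s, of "p i" \<eta>] p \<eta> by (intro add_left_mono mult_left_mono) (auto simp: E_def)
  also have "\<dots> \<le> e + exp (- \<eta> * ln (w J) - \<eta> * (Suc t * (c - \<Lambda> * \<eta> * c) - \<Lambda> * c * (real g - length (filter Q xs))))"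
  proof -
    have side: "(s \<le> m \<and> p i \<le> \<tau>) \<or> (m \<le> s \<and> \<tau> \<le> p i)"
    proof (cases J x rule: linorder_cases)
      case less
      then have "s = b" "p (Suc J) \<le> p i"
        by (auto simp: s_def f_def likelihood_def i_def intro!: pm)
      then show ?thesis using J m by (auto simp: b_def)
    next
      case equal
      then show ?thesis using J by (auto simp: s_def f_def likelihood_def i_def)
    next
      case greater
      then have "s = a" "p i \<le> p J"
        by (auto simp: s_def f_def likelihood_def i_def intro!: pm)
      then show ?thesis using J m by (auto simp: a_def)
    qed
    have near: "- (4 / u) * c \<le> log_gain s m (p i)" by (rule log_gain_near[OF s side])
    \<comment> \<open>Without margin both ends of \<open>x\<close> lie beyond the shrunken band on
      the same side. This rules out \<open>x = J\<close> and determines which of \<open>a\<close>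
      and \<open>b\<close> is the prediction for \<open>J\<close>.\<close>
    have far: "c - 8 / u * \<eta> * c \<le> log_gain s m (p i)" if "\<not> Q x"
    proof -
      have lt: "\<eta> * \<epsilon> < \<epsilon>" using \<eta> eps by simp
      have "\<tau> + \<epsilon> - \<eta> * \<epsilon> \<le> p x \<or> p (Suc x) \<le> \<tau> - \<epsilon> + \<eta> * \<epsilon>"
        using that by (auto simp: Q_def straddles_def)
      then show ?thesis
      proof
        assume *: "\<tau> + \<epsilon> - \<eta> * \<epsilon> \<le> p x"
        have "J < x" using pm[of x J] J(1) * lt by linarith
        then have "s = \<tau> + \<epsilon>" by (simp add: s_def f_def likelihood_def b_def)
        moreover have "p x \<le> p i" by (auto simp: i_def intro!: pm)
        ultimately show ?thesis using log_gain_far(1)[of \<eta> "p i"] * \<eta> by auto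
      next
        assume *: "p (Suc x) \<le> \<tau> - \<epsilon> + \<eta> * \<epsilon>"
        have "x < J" using pm[of "Suc J" "Suc x"] J(2) * lt by linarith
        then have "s = \<tau> - \<epsilon>" by (simp add: s_def f_def likelihood_def a_def)
        moreover have "p i \<le> p (Suc x)" by (auto simp: i_def intro!: pm)
        ultimately show ?thesis using log_gain_far(2)[of \<eta> "p i"] * \<eta> by auto
      qed
    qed
    define y where "y = 1 / u\<^sup>2"
    have y: "4 / u \<le> y" "1 \<le> y" "\<Lambda> = 10 * y" "8 / u\<^sup>2 = 8 * y"
    proof -
      show "4 / u \<le> y" using u by (simp add: y_def power2_eq_square field_simps)
      have "u * u \<le> 1 * 1" using u by (intro mult_mono) auto
      then show "1 \<le> y" using u by (simp add: y_def power2_eq_square)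
    qed (auto simp: \<Lambda>_def y_def)
    have yc: "4 / u * c \<le> y * c" "c \<le> y * c" "8 / u * \<eta> * c \<le> 2 * (y * \<eta> * c)" "0 \<le> y * \<eta> * c"
    proof -
      show "4 / u * c \<le> y * c" "c \<le> y * c"
        using mult_right_mono[OF y(1), of c] mult_right_mono[OF y(2), of c] c_pos by auto
      have "8 / u \<le> 2 * y" using y(1) by simp
      then have "8 / u * (\<eta> * c) \<le> 2 * y * (\<eta> * c)" using \<eta> c_pos by (intro mult_right_mono) auto
      then show "8 / u * \<eta> * c \<le> 2 * (y * \<eta> * c)" by (simp add: mult.assoc)
      show "0 \<le> y * \<eta> * c" using \<eta> c_pos y by simp
    qed
    define h where "h = (if Q x then 1 else 0 :: real)"
    \<comment> \<open>The 10 in \<open>\<Lambda>\<close> is 2 from \<open>log_gain_far\<close> plus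
      8 from the second-order term. A visit to \<open>Q\<close> forgoes at most
      \<open>c + 4 / u * c\<close>, which is below \<open>10 * (y * c)\<close>.\<close>
    have gain: "(c - \<Lambda> * \<eta> * c) - \<Lambda> * c * h \<le> log_gain s m (p i) - 8 / u\<^sup>2 * \<eta> * c"
    proof (cases "Q x")
      case True
      have "c - 10 * (y * \<eta> * c) - 10 * (y * c) \<le> - (4 / u * c) - 8 * (y * \<eta> * c)"
        using yc c_pos by linarith
      then show ?thesis using near True unfolding y h_def by (simp add: mult.assoc)
    next
      case False
      have "c - 10 * (y * \<eta> * c) \<le> c - 8 / u * \<eta> * c - 8 * (y * \<eta> * c)" using yc by linarith
      then show ?thesis using far False unfolding y h_def by (simp add: mult.assoc)
    qed
    have "G = length (filter Q xs) + h" by (simp add: G_def h_def)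
    then have eq: "- \<eta> * ln (w J) - \<eta> * (Suc t * (c - \<Lambda> * \<eta> * c) - \<Lambda> * c * (real g - length (filter Q xs)))
      = - \<eta> * ln (w J) - \<eta> * (t * (c - \<Lambda> * \<eta> * c) - \<Lambda> * c * (real g - G))
        + (- \<eta>) * ((c - \<Lambda> * \<eta> * c) - \<Lambda> * c * h)"
      by (simp add: algebra_simps)
    have "(- \<eta>) * (log_gain s m (p i) - 8 / u\<^sup>2 * \<eta> * c) \<le> (- \<eta>) * ((c - \<Lambda> * \<eta> * c) - \<Lambda> * c * h)"
      using gain \<eta> by (intro mult_left_mono_neg) auto
    then show ?thesis unfolding eq E_def mult_exp_exp by simp
  qed
  finally show ?case unfolding a_def b_def .
qed

end

section \<open>The combined search\<close>

text \<open>The prior is uniform over the \<open>n + 1\<close> intervals of the padded instance. The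
  scan starts from the virtual coin 0, which is certainly low.\<close>

definition screening_search ::
    "real \<Rightarrow> real \<Rightarrow> real \<Rightarrow> real \<Rightarrow> nat \<Rightarrow> nat \<Rightarrow> nat \<Rightarrow> nat \<Rightarrow> search_tree" where
  "screening_search \<tau> \<epsilon> m \<eta> n M Nc Nf =
     learn (\<tau> - \<epsilon>) (\<tau> + \<epsilon>) m n
       (\<lambda>xs. scan Nc Nf \<tau> (\<tau> - \<epsilon> + \<eta> * \<epsilon> / 2) 0 (every_nth (nat \<lceil>\<eta> * M\<rceil>) xs))
       M (\<lambda>_. 1 / (real n + 1)) []"

lemma real_div_ceiling_le:
  assumes "0 < \<eta>"
  shows "real (M div nat \<lceil>\<eta> * M\<rceil>) \<le> 1 / \<eta>"
proof (cases "M = 0")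
  case False
  have "real (M div nat \<lceil>\<eta> * M\<rceil>) \<le> real M / real (nat \<lceil>\<eta> * M\<rceil>)" by (rule of_nat_div_le_of_nat)
  also have "\<dots> \<le> real M / (\<eta> * M)"
    using assms False by (intro divide_left_mono real_nat_ceiling_ge) auto
  also have "\<dots> = 1 / \<eta>" using False by simp
  finally show ?thesis .
qed (use assms in auto)

lemma max_queries_screening_search:
  assumes "0 < \<eta>"
  shows "real (max_queries (screening_search \<tau> \<epsilon> m \<eta> n M Nc Nf)) \<le> M + 1 / \<eta> * Nc + Nf"
proof -
  define g where "g = nat \<lceil>\<eta> * M\<rceil>"
  have "max_queries (screening_search \<tau> \<epsilon> m \<eta> n M Nc Nf) \<le> M + ((M div g) * Nc + Nf)"
    unfolding screening_search_def g_def[symmetric]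
    by (rule max_queries_learn, rule order_trans[OF max_queries_scan]) (simp add: length_every_nth)
  then have "real (max_queries (screening_search \<tau> \<epsilon> m \<eta> n M Nc Nf)) \<le> real (M + ((M div g) * Nc + Nf))"
    by (simp only: of_nat_le_iff)
  also have "\<dots> = M + real (M div g) * Nc + Nf" by simp
  also have "\<dots> \<le> M + 1 / \<eta> * Nc + Nf"
    using real_div_ceiling_le[OF assms, of M] by (intro add_mono mult_right_mono) (auto simp: g_def)
  finally show ?thesis .
qed

lemma crossing_exists:
  fixes p :: "nat \<Rightarrow> real"
  assumes "p 0 \<le> \<tau>" "\<tau> \<le> p (Suc n)"
  obtains J where "J \<le> n" "p J \<le> \<tau>" "\<tau> \<le> p (Suc J)"
proof -
  define J where "J = (LEAST i. \<tau> \<le> p (Suc i))"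
  have "\<tau> \<le> p (Suc J)" "J \<le> n" unfolding J_def using assms(2) by (auto intro: LeastI Least_le)
  moreover have "p J \<le> \<tau>"
  proof (cases J)
    case (Suc i)
    then have "\<not> \<tau> \<le> p (Suc i)" using not_less_Least[of i "\<lambda>i. \<tau> \<le> p (Suc i)"] by (simp add: J_def)
    then show ?thesis using Suc by simp
  qed (use assms in simp)
  ultimately show ?thesis using that by blast
qed

context balanced_channel
begin

text \<open>The failure budget is split into thirds: the learning phase, the at most
  \<open>1 / \<eta>\<close> crude tests with \<open>\<delta> * \<eta> / 3\<close> each, and the
  accurate test.\<close>

lemma miss_prob_screening_search:
  fixes \<eta> \<delta> :: real and p :: "nat \<Rightarrow> real"
  defines "\<Lambda> \<equiv> 10 / u\<^sup>2"
  assumes p: "\<And>i. 0 \<le> p i" "\<And>i. p i \<le> 1" "mono p" "p 0 = 0" "p (Suc n) = 1"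
    and \<eta>: "0 < \<eta>" "\<Lambda> * \<eta> \<le> 1/8" and \<delta>: "0 < \<delta>" "\<delta> < 1/2"
    and M: "(1 + 4 * \<Lambda> * \<eta>) * (ln (real n + 1) + \<Lambda> * c + ln (3 / \<delta>) / \<eta>) \<le> c * M"
    and Nc: "4 * ln (3 / (\<delta> * \<eta>)) \<le> Nc * \<epsilon>\<^sup>2"
    and Nf: "16 * ln (3 / \<delta>) \<le> Nf * (\<eta> * \<epsilon>)\<^sup>2"
  shows "miss_prob p {j. straddles \<tau> \<epsilon> p j} (screening_search \<tau> \<epsilon> m \<eta> n M Nc Nf) \<le> \<delta>"
proof -
  define g where "g = nat \<lceil>\<eta> * M\<rceil>"
  define S where "S = {j. straddles \<tau> \<epsilon> p j}"
  define Q where "Q = straddles \<tau> (\<epsilon> - \<eta> * \<epsilon>) p"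
  have pm: "p i \<le> p j" if "i \<le> j" for i j using p(3) that by (rule monoD)
  have "1 \<le> \<Lambda>"
  proof -
    have "u * u \<le> 1 * 1" using u by (intro mult_mono) auto
    then show ?thesis using u by (simp add: \<Lambda>_def power2_eq_square)
  qed
  then have "1 * \<eta> \<le> \<Lambda> * \<eta>" using \<eta> by (intro mult_right_mono) auto
  then have \<eta>': "\<eta> \<le> 1/8" using \<eta> by linarith
  have eps1: "\<epsilon> \<le> 1" using eps u by simp
  have T: "0 < ln (3 / \<delta>)" using \<delta> by simp
  have X: "0 < ln (real n + 1) + \<Lambda> * c + ln (3 / \<delta>) / \<eta>"
    using T \<eta> c_pos \<open>1 \<le> \<Lambda>\<close> by (intro add_nonneg_pos add_nonneg_nonneg) auto
  have "0 < 1 + 4 * \<Lambda> * \<eta>" using \<eta> \<open>1 \<le> \<Lambda>\<close> by (simp add: add_pos_nonneg)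
  from mult_pos_pos[OF this X] have "0 < c * M" using M by linarith
  then have "0 < M" using c_pos by (simp add: zero_less_mult_iff)
  then have g0: "0 < g" using \<eta> by (simp add: g_def)
  obtain J where J: "J \<le> n" "p J \<le> \<tau>" "\<tau> \<le> p (Suc J)"
    using crossing_exists[of p \<tau> n] p tau u by auto
  have scan: "miss_prob p S (scan Nc Nf \<tau> (\<tau> - \<epsilon> + \<eta> * \<epsilon> / 2) 0 (every_nth g ys)) \<le> 2 * \<delta> / 3"
    if ys: "length ys = M" "g \<le> length (filter Q ys)" for ys
  proof -
    have "\<exists>x\<in>set (every_nth g ys). Q x"
    proof (rule every_nth_meets_convex[OF g0 ys(2)])
      fix x y z :: nat assume "x \<le> y" "y \<le> z" "Q x" "Q z"
      then show "Q y" using pm[of y z] pm[of "Suc x" "Suc y"] by (auto simp: Q_def straddles_def)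
    qed
    then have "miss_prob p S (scan Nc Nf \<tau> (\<tau> - \<epsilon> + \<eta> * \<epsilon> / 2) 0 (every_nth g ys))
      \<le> length (every_nth g ys) * exp (- (Nc * \<epsilon>\<^sup>2 / 4)) + exp (- (Nf * (\<eta> * \<epsilon> / 2)\<^sup>2 / 4))"
      unfolding S_def
      using p eps eps1 \<eta> \<eta>' g0 tau u mult_mono[of \<eta> 1 \<epsilon> 1]
      by (intro miss_prob_scan) (auto simp: Q_def sorted_every_nth)
    also have "\<dots> \<le> 1 / \<eta> * (\<delta> * \<eta> / 3) + \<delta> / 3"
    proof (intro add_mono mult_mono)
      show "real (length (every_nth g ys)) \<le> 1 / \<eta>"
        using real_div_ceiling_le[OF \<eta>(1), of M] ys(1) by (simp add: length_every_nth g_def)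
      have "- (Nc * \<epsilon>\<^sup>2 / 4) \<le> - ln (3 / (\<delta> * \<eta>))" using Nc by simp
      also have "\<dots> = ln (\<delta> * \<eta> / 3)" using \<delta> \<eta> by (simp add: ln_div)
      finally show "exp (- (Nc * \<epsilon>\<^sup>2 / 4)) \<le> \<delta> * \<eta> / 3" using \<delta> \<eta> by (subst ln_ge_iff[symmetric]) auto
      have "- (Nf * (\<eta> * \<epsilon> / 2)\<^sup>2 / 4) \<le> - ln (3 / \<delta>)"
        using Nf by (simp add: power_divide)
      also have "\<dots> = ln (\<delta> / 3)" using \<delta> by (simp add: ln_div)
      finally show "exp (- (Nf * (\<eta> * \<epsilon> / 2)\<^sup>2 / 4)) \<le> \<delta> / 3" using \<delta> by (subst ln_ge_iff[symmetric]) auto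
    qed (use \<eta> in auto)
    also have "\<dots> = 2 * \<delta> / 3" using \<eta> by simp
    finally show ?thesis .
  qed
  have "miss_prob p S (screening_search \<tau> \<epsilon> m \<eta> n M Nc Nf)
    \<le> 2 * \<delta> / 3 + exp (- \<eta> * ln (1 / (real n + 1)) - \<eta> * (M * (c - \<Lambda> * \<eta> * c)
        - \<Lambda> * c * (real g - length (filter Q []))))"
    unfolding screening_search_def g_def[symmetric] \<Lambda>_def Q_def
  proof (rule miss_prob_learn)
    show "(\<Sum>j\<le>n. 1 / (real n + 1)) = 1" by simp
  qed (use p J \<eta> \<eta>' \<delta> scan in \<open>auto simp: Q_def\<close>)
  also have "exp (- \<eta> * ln (1 / (real n + 1)) - \<eta> * (M * (c - \<Lambda> * \<eta> * c)
      - \<Lambda> * c * (real g - length (filter Q [])))) \<le> \<delta> / 3"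
  proof -
    define y where "y = \<Lambda> * \<eta>"
    define X where "X = ln (real n + 1) + \<Lambda> * c + ln (3 / \<delta>) / \<eta>"
    have y: "0 \<le> y" "y \<le> 1/8" using \<eta> \<open>1 \<le> \<Lambda>\<close> by (auto simp: y_def)
    \<comment> \<open>The factor \<open>1 - 2 * y\<close> collects two equal losses, the drift
      correction and the charge for \<open>\<eta> * M\<close> visits with margin;
      \<open>1 + 4 * y\<close> compensates it since \<open>y \<le> 1/8\<close>.\<close>
    have "X * 1 \<le> X * ((1 + 4 * y) * (1 - 2 * y))"
    proof (rule mult_left_mono)
      have "y * y \<le> y * (1/8)" using y by (intro mult_left_mono) auto
      then show "1 \<le> (1 + 4 * y) * (1 - 2 * y)" using y by (simp add: algebra_simps)
    qed (use X in \<open>simp add: X_def\<close>)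
    also have "\<dots> = ((1 + 4 * y) * X) * (1 - 2 * y)" by simp
    also have "\<dots> \<le> (c * M) * (1 - 2 * y)"
      using M y by (intro mult_right_mono) (auto simp: X_def y_def mult.assoc)
    finally have 1: "X \<le> (c * M) * (1 - 2 * y)" by simp
    \<comment> \<open>Rounding \<open>g\<close> up costs one more \<open>\<Lambda> * c\<close>,
      which \<open>X\<close> provides for.\<close>
    have "real g \<le> \<eta> * M + 1" using \<eta> unfolding g_def
      by (simp add: of_nat_nat) 
    then have "\<Lambda> * c * real g \<le> \<Lambda> * c * (\<eta> * M + 1)"
      using c_pos \<open>1 \<le> \<Lambda>\<close> by (intro mult_left_mono) auto
    then have "X - \<Lambda> * c \<le> M * (c - \<Lambda> * \<eta> * c) - \<Lambda> * c * real g"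
      using 1 by (simp add: y_def algebra_simps)
    then have "ln (3 / \<delta>) / \<eta> \<le> M * (c - \<Lambda> * \<eta> * c) - \<Lambda> * c * real g - ln (real n + 1)"
      by (simp add: X_def)
    then have "\<eta> * (ln (3 / \<delta>) / \<eta>) \<le> \<eta> * (M * (c - \<Lambda> * \<eta> * c) - \<Lambda> * c * real g - ln (real n + 1))"
      using \<eta> by (intro mult_left_mono) auto
    then have "ln (3 / \<delta>) \<le> \<eta> * (M * (c - \<Lambda> * \<eta> * c) - \<Lambda> * c * real g - ln (real n + 1))"
      using \<eta> by simp
    then have "- \<eta> * ln (1 / (real n + 1)) - \<eta> * (M * (c - \<Lambda> * \<eta> * c)
        - \<Lambda> * c * (real g - length (filter Q []))) \<le> - ln (3 / \<delta>)"
      by (simp add: ln_div algebra_simps)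
    also have "\<dots> = ln (\<delta> / 3)" using \<delta> by (simp add: ln_div)
    finally show ?thesis using \<delta> by (subst ln_ge_iff[symmetric]) auto
  qed
  finally show ?thesis by (simp add: S_def)
qed

end

section \<open>Choice of the parameters and the query count\<close>

lemma tradeoff_bounds:
  fixes L D \<eta>0 :: real
  assumes L: "0 < L" and D: "0 < D" and \<eta>0: "0 < \<eta>0" "\<eta>0 \<le> 1"
  defines "\<eta> \<equiv> \<eta>0 * min 1 ((D / L) powr (1 / 3))"
    and "E \<equiv> L powr (2 / 3) * D powr (1 / 3) + D"
  shows "0 < \<eta>" "\<eta> \<le> \<eta>0" "\<eta> * L \<le> E" "D / \<eta>\<^sup>2 \<le> E / \<eta>0\<^sup>2"
proof -
  define r where "r = min 1 ((D / L) powr (1 / 3))"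
  have r: "0 < r" "r \<le> 1" using L D by (auto simp: r_def)
  have \<eta>: "\<eta> = \<eta>0 * r" by (simp add: \<eta>_def r_def)
  show "0 < \<eta>" using r \<eta>0 by (simp add: \<eta>)
  show "\<eta> \<le> \<eta>0" using mult_left_mono[OF r(2), of \<eta>0] \<eta>0 by (simp add: \<eta>)
  have "r * L \<le> E \<and> D / r\<^sup>2 \<le> E"
  proof (cases "L \<le> D")
    \<comment> \<open>Here the cap makes \<open>r = 1\<close>, and the summand \<open>D\<close> of
      \<open>E\<close> alone covers both costs.\<close>
    case True
    have "1 \<le> (D / L) powr (1 / 3)" using True L by (intro ge_one_powr_ge_zero) auto
    then have "r = 1" by (simp add: r_def)
    moreover have "0 \<le> L powr (2 / 3) * D powr (1 / 3)" by simp
    ultimately show ?thesis using True by (simp add: E_def del: powr_ge_zero)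
  next
    case False
    \<comment> \<open>In terms of the cube roots \<open>r = y / x\<close>, and the two costs
      balance: both equal \<open>x\<^sup>2 * y\<close>.\<close>
    define x y where "x = L powr (1 / 3)" and "y = D powr (1 / 3)"
    have xy: "0 < x" "0 < y" using L D by (auto simp: x_def y_def)
    have LD: "L = x ^ 3" "D = y ^ 3" using L D by (auto simp: x_def y_def powr_power)
    have "L powr (2 / 3) = x\<^sup>2" using L by (simp add: x_def powr_power)
    then have "E = x\<^sup>2 * y + D" by (simp add: E_def y_def)
    moreover have "r = y / x"
    proof -
      have "(D / L) powr (1 / 3) \<le> 1" using False L D by (intro powr_le1) auto
      then show ?thesis using L D by (simp add: r_def x_def y_def powr_divide)
    qed
    moreover have "y / x * x ^ 3 = x\<^sup>2 * y" "y ^ 3 / (y / x)\<^sup>2 = x\<^sup>2 * y"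
      using xy by (simp_all add: power2_eq_square power3_eq_cube)
    then have "y / x * L = x\<^sup>2 * y" "D / (y / x)\<^sup>2 = x\<^sup>2 * y" by (simp_all only: LD)
    ultimately show ?thesis using D by simp
  qed
  then have rL: "r * L \<le> E" and Dr: "D / r\<^sup>2 \<le> E" by auto
  have "\<eta> * L \<le> 1 * (r * L)" unfolding \<eta> mult.assoc using \<eta>0 r L by (intro mult_right_mono) auto
  then show "\<eta> * L \<le> E" using rL by simp
  have "D / \<eta>\<^sup>2 = (D / r\<^sup>2) / \<eta>0\<^sup>2" by (simp add: \<eta> power_mult_distrib)
  also have "\<dots> \<le> E / \<eta>0\<^sup>2" using Dr by (intro divide_right_mono) auto
  finally show "D / \<eta>\<^sup>2 \<le> E / \<eta>0\<^sup>2" .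
qed

lemma real_nat_ceiling_le: "0 \<le> x \<Longrightarrow> real (nat \<lceil>x\<rceil>) \<le> x + 1"
  by simp

context balanced_channel
begin

text \<open>All terms besides \<open>ln n\<close> and the one proportional to
  \<open>\<eta> * log 2 n\<close> are absorbed into \<open>D / \<eta>\<^sup>2\<close>, using
  \<open>1 \<le> D\<close>, \<open>1 \<le> 1 / \<eta>\<close>, \<open>c \<le> 2\<close> and
  \<open>c / \<epsilon>\<^sup>2 \<le> 8 / u\<close>. The isolated ones account for rounding the test
  lengths up.\<close>

lemma query_bound:
  fixes \<eta> \<delta> :: real and n :: nat
  defines "\<Lambda> \<equiv> 10 / u\<^sup>2" and "D \<equiv> log 2 (1 / \<delta>)"
  assumes \<eta>: "0 < \<eta>" "\<Lambda> * \<eta> \<le> 1/8" "\<eta> \<le> 1" and \<delta>: "0 < \<delta>" "\<delta> < 1/2" and n: "1 \<le> n"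
  shows "c * ((1 + 4 * \<Lambda> * \<eta>) * (ln (real n + 1) + \<Lambda> * c + ln (3 / \<delta>) / \<eta>) / c + 1
      + 1 / \<eta> * (4 * ln (3 / (\<delta> * \<eta>)) / \<epsilon>\<^sup>2 + 1) + (16 * ln (3 / \<delta>) / (\<eta> * \<epsilon>)\<^sup>2 + 1))
    \<le> ln n + 4 * \<Lambda> * (\<eta> * log 2 n) + (14 + 4 * \<Lambda> + 512 / u) * (D / \<eta>\<^sup>2)"
proof -
  define F where "F = D / \<eta>\<^sup>2"
  define T where "T = ln (3 / \<delta>)"
  define r where "r = 1 / \<eta>"
  have r: "1 \<le> r" using \<eta> by (simp add: r_def)
  have F: "F = D * r * r" by (simp add: F_def r_def power2_eq_square)
  have ln2: "0 < ln (2::real)" "ln (2::real) \<le> 1" using ln_2_less_1 by auto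
  have D: "1 \<le> D" using \<delta> by (simp add: D_def le_log_iff field_simps)
  have rD: "1 * 1 \<le> r * r" "1 * 1 \<le> D * r" using D r by (intro mult_mono; simp)+
  have "D * (1 * 1) \<le> D * (r * r)" "1 * 1 * r \<le> D * r * r" "1 * (r * r) \<le> D * (r * r)"
    "D * r * 1 \<le> D * r * r"
    using D r rD by (intro mult_left_mono mult_right_mono; simp)+
  then have leF: "D \<le> F" "r \<le> F" "r * r \<le> F" "D * r \<le> F" "1 \<le> F" using D by (auto simp: F)
  have \<Lambda>: "0 < \<Lambda>" using u by (simp add: \<Lambda>_def)
  have "\<epsilon> * \<epsilon> \<le> u * (1/4)" using eps u by (intro mult_mono) auto
  then have "8 * \<epsilon>\<^sup>2 / u \<le> 2" using u by (simp add: pos_divide_le_eq power2_eq_square)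
  then have c2: "c \<le> 2" using c_le by linarith
  have T0: "0 \<le> T" using \<delta> by (simp add: T_def)
  have T: "T \<le> 3 * D"
  proof -
    have "T \<le> ln (2 * 2 * (1 / \<delta>))" using \<delta> by (auto simp: T_def intro!: divide_right_mono)
    also have "\<dots> = ln (2 * 2) + ln (1 / \<delta>)" using \<delta> by (intro ln_mult_pos) auto
    also have "ln (2 * 2 :: real) = ln 2 + ln 2" by (intro ln_mult_pos) auto
    also have "ln (1 / \<delta>) = D * ln 2" by (simp add: D_def log_def)
    also have "D * ln 2 \<le> D * 1" using D ln2 by (intro mult_left_mono) auto
    finally show ?thesis using D ln2 by linarith
  qed
  have Tc: "ln (3 / (\<delta> * \<eta>)) \<le> 3 * D + r"
  proof -
    have "ln (3 / (\<delta> * \<eta>)) = T + ln r"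
      using \<delta> \<eta> ln_mult[of "3 / \<delta>" r] by (simp add: T_def r_def)
    moreover have "ln r \<le> r - 1" using r by (intro ln_le_minus_one) auto
    ultimately show ?thesis using T by linarith
  qed
  have ln_n: "ln n \<le> log 2 n"
  proof -
    have "ln (real n) * ln 2 \<le> ln (real n) * 1" using ln2 n by (intro mult_left_mono) auto
    then show ?thesis using ln2 by (simp add: log_def field_simps)
  qed
  have ln_n1: "ln (real n + 1) \<le> ln n + 1"
  proof -
    have "ln (real n + 1) \<le> ln (2 * real n)" using n by simp
    also have "\<dots> = ln 2 + ln n" using n by (simp add: ln_mult)
    finally show ?thesis using ln2 by simp
  qed
  have "c * ((1 + 4 * \<Lambda> * \<eta>) * (ln (real n + 1) + \<Lambda> * c + T / \<eta>) / c)
      = (1 + 4 * \<Lambda> * \<eta>) * (ln (real n + 1) + \<Lambda> * c + T * r)"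
    using c_pos by (simp add: r_def)
  also have "\<dots> \<le> (1 + 4 * \<Lambda> * \<eta>) * (ln n + (1 + 2 * \<Lambda> + 3 * F))"
  proof (rule mult_left_mono)
    have "T * r \<le> 3 * D * r" using T r by (intro mult_right_mono) auto
    moreover have "\<Lambda> * c \<le> \<Lambda> * 2" using c2 \<Lambda> by (intro mult_left_mono) auto
    ultimately show "ln (real n + 1) + \<Lambda> * c + T * r \<le> ln n + (1 + 2 * \<Lambda> + 3 * F)"
      using ln_n1 leF by linarith
  qed (use \<Lambda> \<eta> in auto)
  also have "\<dots> = ln n + 4 * \<Lambda> * (\<eta> * ln n) + (1 + 4 * (\<Lambda> * \<eta>)) * (1 + 2 * \<Lambda> + 3 * F)"
    by (simp add: algebra_simps)
  also have "\<dots> \<le> ln n + 4 * \<Lambda> * (\<eta> * log 2 n) + 2 * (1 + 2 * \<Lambda> + 3 * F)"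
    using ln_n \<Lambda> \<eta> leF by (intro add_mono mult_left_mono mult_right_mono) auto
  also have "\<dots> \<le> ln n + 4 * \<Lambda> * (\<eta> * log 2 n) + (8 + 4 * \<Lambda>) * F"
  proof -
    have "\<Lambda> * 1 \<le> \<Lambda> * F" using \<Lambda> leF by (intro mult_left_mono) auto
    then show ?thesis using leF by (simp add: algebra_simps)
  qed
  finally have 1: "c * ((1 + 4 * \<Lambda> * \<eta>) * (ln (real n + 1) + \<Lambda> * c + T / \<eta>) / c)
      \<le> ln n + 4 * \<Lambda> * (\<eta> * log 2 n) + (8 + 4 * \<Lambda>) * F" .
  have ceps: "c / \<epsilon>\<^sup>2 \<le> 8 / u" using c_le eps by (simp add: field_simps)
  have 2: "c * (1 / \<eta> * (4 * ln (3 / (\<delta> * \<eta>)) / \<epsilon>\<^sup>2)) \<le> 128 / u * F"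
  proof -
    have "c * (1 / \<eta> * (4 * ln (3 / (\<delta> * \<eta>)) / \<epsilon>\<^sup>2)) = (c / \<epsilon>\<^sup>2) * (4 * (r * ln (3 / (\<delta> * \<eta>))))"
      by (simp add: r_def)
    also have "\<dots> \<le> (c / \<epsilon>\<^sup>2) * (4 * (r * (3 * D + r)))"
      using Tc r c_pos by (intro mult_left_mono) auto
    also have "\<dots> \<le> (8 / u) * (4 * (4 * F))"
    proof (rule mult_mono[OF ceps])
      show "4 * (r * (3 * D + r)) \<le> 4 * (4 * F)" using leF by (simp add: algebra_simps)
    qed (use r D u in auto)
    finally show ?thesis by simp
  qed
  have 3: "c * (16 * T / (\<eta> * \<epsilon>)\<^sup>2) \<le> 384 / u * F"
  proof -
    have "c * (16 * T / (\<eta> * \<epsilon>)\<^sup>2) = (c / \<epsilon>\<^sup>2) * (16 * (T * r * r))"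
      by (simp add: r_def power2_eq_square)
    also have "\<dots> \<le> (8 / u) * (16 * (3 * D * r * r))"
    proof (rule mult_mono[OF ceps])
      show "16 * (T * r * r) \<le> 16 * (3 * D * r * r)"
        using T r by (intro mult_left_mono mult_right_mono) auto
    qed (use T0 r u in auto)
    finally show ?thesis by (simp add: F)
  qed
  have 4: "c * 1 \<le> 2 * F" "c * r \<le> 2 * F" using c2 leF r c_pos by (auto intro!: mult_mono)
  have "c * ((1 + 4 * \<Lambda> * \<eta>) * (ln (real n + 1) + \<Lambda> * c + T / \<eta>) / c + 1
      + 1 / \<eta> * (4 * ln (3 / (\<delta> * \<eta>)) / \<epsilon>\<^sup>2 + 1) + (16 * T / (\<eta> * \<epsilon>)\<^sup>2 + 1))
    = c * ((1 + 4 * \<Lambda> * \<eta>) * (ln (real n + 1) + \<Lambda> * c + T / \<eta>) / c)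
      + c * (1 / \<eta> * (4 * ln (3 / (\<delta> * \<eta>)) / \<epsilon>\<^sup>2)) + c * (16 * T / (\<eta> * \<epsilon>)\<^sup>2) + c * 1 + c * 1 + c * r"
    by (simp only: distrib_left r_def mult_1_right)
  also have "\<dots> \<le> ln n + 4 * \<Lambda> * (\<eta> * log 2 n) + (8 + 4 * \<Lambda>) * F + 128 / u * F + 384 / u * F
      + 2 * F + 2 * F + 2 * F"
    using 1 2 3 4 by linarith
  also have "\<dots> = ln n + 4 * \<Lambda> * (\<eta> * log 2 n) + (14 + 4 * \<Lambda> + 512 / u) * F"
    by (simp add: algebra_simps add_divide_distrib[symmetric])
  finally show ?thesis unfolding T_def F_def .
qed

end

text \<open>A single deterministic tree serves all instances. \<open>K\<close> depends on
  \<open>\<tau>\<close> only, through \<open>u\<close>, and its division by \<open>ln 2\<close>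
  changes nats into bits.\<close>

lemma search_tree_exists:
  fixes \<tau> \<epsilon> \<delta> :: real and n :: nat
  defines "u \<equiv> min \<tau> (1 - \<tau>) / 2"
  defines "K \<equiv> (320 / u\<^sup>2 + (14 + 40 / u\<^sup>2 + 512 / u) * (80 / u\<^sup>2)\<^sup>2) / ln 2"
  assumes "0 < \<tau>" "\<tau> < 1" "2 \<le> n" "0 < \<epsilon>" "\<epsilon> < u" "0 < \<delta>" "\<delta> < 1/2"
  shows "\<exists>t. coins_queried t \<subseteq> {1..n} \<and>
    real (max_queries t) \<le> 1 / bac_capacity \<tau> \<epsilon> * (log 2 n +
      K * (log 2 n powr (2 / 3) * log 2 (1 / \<delta>) powr (1 / 3) + log 2 (1 / \<delta>))) \<and>
    (\<forall>p. nbs_instance n p \<and> (\<exists>i. good_index \<tau> \<epsilon> n p i) \<longrightarrow>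
      1 - \<delta> \<le> measure_pmf.prob (run_tree p t) {i. good_index \<tau> \<epsilon> n p i})"
proof -
  have u': "2 * u \<le> \<tau>" "2 * u \<le> 1 - \<tau>" "0 < u" "u \<le> 1/4" using assms(3,4) by (auto simp: u_def min_def)
  obtain m where m: "\<tau> - \<epsilon> < m" "m < \<tau> + \<epsilon>" "rel_entropy (\<tau> - \<epsilon>) m = rel_entropy (\<tau> + \<epsilon>) m"
    using rel_entropy_balance_point[of "\<tau> - \<epsilon>" "\<tau> + \<epsilon>"] u' assms(3-) by auto
  define c where "c = rel_entropy (\<tau> + \<epsilon>) m"
  interpret balanced_channel \<tau> \<epsilon> m c u
    by unfold_locales (use assms(3-) u' m in \<open>auto simp: c_def\<close>)
  define \<Lambda> where "\<Lambda> = 10 / u\<^sup>2"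
  define D where "D = log 2 (1 / \<delta>)"
  define L where "L = log 2 n"
  define E where "E = L powr (2 / 3) * D powr (1 / 3) + D"
  \<comment> \<open>Chosen so that \<open>\<Lambda> * \<eta>0 = 1/8\<close>.\<close>
  define \<eta>0 where "\<eta>0 = u\<^sup>2 / 80"
  have u2: "0 < u\<^sup>2" "u\<^sup>2 \<le> 1" using u'(3,4) by (simp_all add: power_le_one)
  have D: "1 \<le> D" using assms(8,9) by (simp add: D_def le_log_iff field_simps)
  have L: "1 \<le> L" using assms(3-) by (simp add: L_def)
  have \<eta>0: "0 < \<eta>0" "\<eta>0 \<le> 1" using u2 by (auto simp: \<eta>0_def)
  define \<eta> where "\<eta> = \<eta>0 * min 1 ((D / L) powr (1 / 3))"
  have \<eta>: "0 < \<eta>" "\<eta> \<le> \<eta>0" "\<eta> * L \<le> E" "D / \<eta>\<^sup>2 \<le> E / \<eta>0\<^sup>2"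
    using tradeoff_bounds[of L D \<eta>0] D L \<eta>0 unfolding \<eta>_def E_def by auto
  have \<Lambda>0: "0 < \<Lambda>" using u2 by (simp add: \<Lambda>_def)
  have "\<Lambda> * \<eta> \<le> \<Lambda> * \<eta>0" using \<eta> \<Lambda>0 by (intro mult_left_mono) auto
  also have "\<dots> = 1/8" using u2 by (simp add: \<Lambda>_def \<eta>0_def)
  finally have \<Lambda>\<eta>: "\<Lambda> * \<eta> \<le> 1/8" .
  define xM where "xM = (1 + 4 * \<Lambda> * \<eta>) * (ln (real n + 1) + \<Lambda> * c + ln (3 / \<delta>) / \<eta>) / c"
  define xc where "xc = 4 * ln (3 / (\<delta> * \<eta>)) / \<epsilon>\<^sup>2"
  define xf where "xf = 16 * ln (3 / \<delta>) / (\<eta> * \<epsilon>)\<^sup>2"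
  define M Nc Nf where "M = nat \<lceil>xM\<rceil>" and "Nc = nat \<lceil>xc\<rceil>" and "Nf = nat \<lceil>xf\<rceil>"
  have "\<delta> * \<eta> \<le> 1 * 1" using assms(3-) \<eta> \<eta>0 by (intro mult_mono) auto
  then have "1 \<le> 3 / (\<delta> * \<eta>)" using assms(3-) \<eta> by simp
  then have x0: "0 \<le> xM" "0 \<le> xc" "0 \<le> xf"
    unfolding xM_def xc_def xf_def using assms(3-) \<eta> \<Lambda>0 c_pos
    by (auto intro!: divide_nonneg_nonneg mult_nonneg_nonneg add_nonneg_nonneg ln_ge_zero)
  have up: "M \<le> xM + 1" "Nc \<le> xc + 1" "Nf \<le> xf + 1"
    unfolding M_def Nc_def Nf_def using x0 real_nat_ceiling_le by auto
  have lo: "xM \<le> M" "xc \<le> Nc" "xf \<le> Nf"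
    unfolding M_def Nc_def Nf_def by (auto intro: real_nat_ceiling_ge)
  define t where "t = screening_search \<tau> \<epsilon> m \<eta> n M Nc Nf"
  have queries: "real (max_queries t) \<le> 1 / bac_capacity \<tau> \<epsilon> * (L + K * E)"
  proof -
    have "real (max_queries t) \<le> M + 1 / \<eta> * Nc + Nf"
      unfolding t_def by (rule max_queries_screening_search[OF \<eta>(1)])
    also have "\<dots> \<le> (xM + 1) + 1 / \<eta> * (xc + 1) + (xf + 1)"
      using up \<eta> by (intro add_mono mult_left_mono) auto
    finally have "c * real (max_queries t) \<le> c * (xM + 1 + 1 / \<eta> * (xc + 1) + (xf + 1))"
      using c_pos by (intro mult_left_mono) auto
    also have "\<dots> \<le> ln n + 4 * \<Lambda> * (\<eta> * L) + (14 + 4 * \<Lambda> + 512 / u) * (D / \<eta>\<^sup>2)"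
      using query_bound[of \<eta> \<delta> n] \<eta> \<eta>0 \<Lambda>\<eta> assms(3-)
      unfolding xM_def xc_def xf_def \<Lambda>_def D_def L_def by auto
    also have "\<dots> \<le> ln n + 4 * \<Lambda> * E + (14 + 4 * \<Lambda> + 512 / u) * (E / \<eta>0\<^sup>2)"
      using \<eta> \<Lambda>0 u' by (intro add_mono mult_left_mono) auto
    also have "\<dots> \<le> ln 2 * (L + K * E)"
    proof -
      have "ln 2 * (L + K * E) = ln n + (320 / u\<^sup>2 + (14 + 40 / u\<^sup>2 + 512 / u) * (80 / u\<^sup>2)\<^sup>2) * E"
        by (simp add: L_def K_def log_def distrib_left)
      moreover have "E / \<eta>0\<^sup>2 = (80 / u\<^sup>2)\<^sup>2 * E" by (simp add: \<eta>0_def power_divide)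
      \<comment> \<open>Here \<open>4 * \<Lambda>\<close> is \<open>40 / u\<^sup>2\<close>, so the
        320 in \<open>K\<close> is generous.\<close>
      moreover have "4 * \<Lambda> * E \<le> 320 / u\<^sup>2 * E"
        using u2 D by (intro mult_right_mono) (auto simp: \<Lambda>_def E_def divide_right_mono)
      ultimately show ?thesis by (simp add: \<Lambda>_def distrib_right mult.assoc)
    qed
    finally show ?thesis using c_pos unfolding capacity by (simp add: field_simps)
  qed
  have success: "1 - \<delta> \<le> measure_pmf.prob (run_tree p (prune n t)) {i. good_index \<tau> \<epsilon> n p i}"
    if inst: "nbs_instance n p" and ex: "\<exists>i. good_index \<tau> \<epsilon> n p i" for p
  proof -
    have "miss_prob p {i. good_index \<tau> \<epsilon> n p i} (prune n t)
        \<le> miss_prob (pad n p) {j. straddles \<tau> \<epsilon> (pad n p) j} t"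
      using straddles_pad_clamp[OF inst _ _ _ _ ex] assms(3-) u'
      by (intro miss_prob_prune[OF inst]) auto
    also have "\<dots> \<le> \<delta>" unfolding t_def
    proof (rule miss_prob_screening_search)
      show "(1 + 4 * (10 / u\<^sup>2) * \<eta>) * (ln (real n + 1) + 10 / u\<^sup>2 * c + ln (3 / \<delta>) / \<eta>) \<le> c * M"
        using lo(1) c_pos unfolding xM_def \<Lambda>_def by (simp add: pos_divide_le_eq mult.commute)
      show "4 * ln (3 / (\<delta> * \<eta>)) \<le> Nc * \<epsilon>\<^sup>2"
        using lo(2) assms(3-) unfolding xc_def by (simp add: pos_divide_le_eq)
      show "16 * ln (3 / \<delta>) \<le> Nf * (\<eta> * \<epsilon>)\<^sup>2"
        using lo(3) assms(3-) \<eta> unfolding xf_def by (simp add: pos_divide_le_eq)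
      show "10 / u\<^sup>2 * \<eta> \<le> 1 / 8" using \<Lambda>\<eta> by (simp add: \<Lambda>_def)
    qed (use pad_bounds[OF inst] mono_pad[OF inst] \<eta> assms(3-) in \<open>auto simp: pad_def\<close>)
    finally show ?thesis
      using inst coins_queried_prune[of n t]
      by (subst prob_run_tree) (auto simp: nbs_instance_def image_subset_iff subset_iff)
  qed
  show ?thesis
  proof (intro exI[of _ "prune n t"] conjI coins_queried_prune allI impI)
    have "real (max_queries (prune n t)) \<le> real (max_queries t)"
      using max_queries_prune[of n t] by simp
    then show "real (max_queries (prune n t)) \<le> 1 / bac_capacity \<tau> \<epsilon> * (log 2 n +
        K * (log 2 n powr (2 / 3) * log 2 (1 / \<delta>) powr (1 / 3) + log 2 (1 / \<delta>)))"
      using queries unfolding L_def D_def E_def by linarith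
  qed (use success in auto)
qed

theorem theorem1:
  fixes \<tau> :: real
  assumes "0 < \<tau>" and "\<tau> < 1"
  shows "\<exists>(alg :: nat \<Rightarrow> real \<Rightarrow> real \<Rightarrow> search_tree pmf) (K :: real).
    \<forall>n\<ge>2. \<forall>\<epsilon> \<delta> :: real.
      0 < \<epsilon> \<and> \<epsilon> < 1 / 2 \<and> 0 < \<delta> \<and> \<delta> < 1 / 2 \<and> \<epsilon> < min \<tau> (1 - \<tau>) / 2 \<longrightarrow>
        (\<forall>t\<in>set_pmf (alg n \<epsilon> \<delta>).
           coins_queried t \<subseteq> {1..n} \<and>
           real (max_queries t) \<le> 1 / bac_capacity \<tau> \<epsilon> *
             (log 2 (real n) +
              K * (log 2 (real n) powr (2 / 3) * log 2 (1 / \<delta>) powr (1 / 3)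
                   + log 2 (1 / \<delta>)))) \<and>
        (\<forall>p. nbs_instance n p \<and> (\<exists>i. good_index \<tau> \<epsilon> n p i) \<longrightarrow>
           measure_pmf.prob (run_alg p (alg n \<epsilon> \<delta>)) {i. good_index \<tau> \<epsilon> n p i} \<ge> 1 - \<delta>)"
proof -
  obtain K where K: "\<And>n \<epsilon> \<delta>. 2 \<le> n \<Longrightarrow> 0 < \<epsilon> \<Longrightarrow> \<epsilon> < min \<tau> (1 - \<tau>) / 2 \<Longrightarrow> 0 < \<delta> \<Longrightarrow> \<delta> < 1/2 \<Longrightarrow>
    \<exists>t. coins_queried t \<subseteq> {1..n} \<and>
      real (max_queries t) \<le> 1 / bac_capacity \<tau> \<epsilon> * (log 2 n +
        K * (log 2 n powr (2 / 3) * log 2 (1 / \<delta>) powr (1 / 3) + log 2 (1 / \<delta>))) \<and>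
      (\<forall>p. nbs_instance n p \<and> (\<exists>i. good_index \<tau> \<epsilon> n p i) \<longrightarrow>
        1 - \<delta> \<le> measure_pmf.prob (run_tree p t) {i. good_index \<tau> \<epsilon> n p i})"
    (is "\<And>n \<epsilon> \<delta>. _ \<Longrightarrow> _ \<Longrightarrow> _ \<Longrightarrow> _ \<Longrightarrow> _ \<Longrightarrow> \<exists>t. ?P n \<epsilon> \<delta> K t")
    using search_tree_exists[OF assms] by blast
  \<comment> \<open>The algorithm needs no randomness of its own: a point mass at a tree fixed by
    \<open>n\<close>, \<open>\<epsilon>\<close> and \<open>\<delta>\<close>.\<close>
  define alg where "alg n \<epsilon> \<delta> = return_pmf (SOME t. ?P n \<epsilon> \<delta> K t)" for n \<epsilon> \<delta>
  show ?thesis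
  proof (intro exI[of _ alg] exI[of _ K] allI impI, elim conjE)
    fix n :: nat and \<epsilon> \<delta> :: real
    assume "2 \<le> n" "0 < \<epsilon>" "\<epsilon> < min \<tau> (1 - \<tau>) / 2" "0 < \<delta>" "\<delta> < 1/2"
    from someI_ex[OF K[OF this]]
    show "(\<forall>t\<in>set_pmf (alg n \<epsilon> \<delta>).
           coins_queried t \<subseteq> {1..n} \<and>
           real (max_queries t) \<le> 1 / bac_capacity \<tau> \<epsilon> *
             (log 2 (real n) +
              K * (log 2 (real n) powr (2 / 3) * log 2 (1 / \<delta>) powr (1 / 3)
                   + log 2 (1 / \<delta>)))) \<and>
        (\<forall>p. nbs_instance n p \<and> (\<exists>i. good_index \<tau> \<epsilon> n p i) \<longrightarrow>
           measure_pmf.prob (run_alg p (alg n \<epsilon> \<delta>)) {i. good_index \<tau> \<epsilon> n p i} \<ge> 1 - \<delta>)"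
      by (simp add: alg_def run_alg_def bind_return_pmf)
  qed
qed

end
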